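(* Let $A$ be a unital C$^*$-algebra and let $J_A$ be its strong radical. (i) $\omega(J_A)=0$ for each maximally mixed state $\omega$ on $A$. (ii) If a state $\omega$ on $A$ annihilates some intersection $M_1\cap M_2\cap\ldots\cap M_n$ of finitely many maximal ideals in $A$, then $\omega$ is maximally mixed. Thus the set $S_m(A)$ of maximally mixed states on $A$ is a weak* dense subset of $S(A/J_A)$, the set of states on $A$ that annihilate $J_A$.
   Context: Ideals are norm closed and two-sided. The strong radical $J_A$ is the intersection of all maximal ideals of $A$. $\mathrm{E}(A)$ denotes the set of all maps $A\to A$ of the form $x\mapsto\sum_{i=1}^n a_i^*xa_i$ with $n\in\mathbb{N}$, $a_i\in A$ and $\sum_{i=1}^n a_i^*a_i=1$. For a state $\omega$ on $A$, $\overline{\omega\circ\mathrm{E}(A)}$ is the weak* closure of $\{\omega\circ\psi:\ \psi\in\mathrm{E}(A)\}$. A state $\omega$ on $A$ is maximally mixed if for each state $\rho$ on $A$, $\rho\in\overline{\omega\circ\mathrm{E}(A)}$ implies $\omega\in\overline{\rho\circ\mathrm{E}(A)}$. *)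

theory Defs
  imports "HOL-Analysis.Analysis"
begin

text \<open>
  The library provides real Banach algebras only; the complex scalar multiplication is required to
  extend the given real one.  The superclass \<^class>\<open>real_normed_algebra_1\<close> includes
  \<open>norm 1 = 1\<close>, so the zero algebra (which has no states) is excluded.
\<close>

class unital_cstar_algebra = real_normed_algebra_1 + banach +
  fixes scaleC :: "complex \<Rightarrow> 'a \<Rightarrow> 'a" (infixr \<open>*\<^sub>C\<close> 75)
    and adj :: "'a \<Rightarrow> 'a"
  assumes scaleC_of_real: "complex_of_real r *\<^sub>C x = r *\<^sub>R x"
    and scaleC_add_right: "c *\<^sub>C (x + y) = c *\<^sub>C x + c *\<^sub>C y"
    and scaleC_add_left: "(c + d) *\<^sub>C x = c *\<^sub>C x + d *\<^sub>C x"
    and scaleC_scaleC: "c *\<^sub>C d *\<^sub>C x = (c * d) *\<^sub>C x"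
    and mult_scaleC_left: "(c *\<^sub>C x) * y = c *\<^sub>C (x * y)"
    and mult_scaleC_right: "x * (c *\<^sub>C y) = c *\<^sub>C (x * y)"
    and norm_scaleC: "norm (c *\<^sub>C x) = cmod c * norm x"
    and adj_adj: "adj (adj x) = x"
    and adj_add: "adj (x + y) = adj x + adj y"
    and adj_scaleC: "adj (c *\<^sub>C x) = cnj c *\<^sub>C adj x"
    and adj_mult: "adj (x * y) = adj y * adj x"
    and cstar_identity: "norm (adj x * x) = (norm x)\<^sup>2"

definition is_ideal :: "'a::unital_cstar_algebra set \<Rightarrow> bool" where
  "is_ideal I \<longleftrightarrow> closed I \<and> 0 \<in> I \<and> (\<forall>x\<in>I. \<forall>y\<in>I. x + y \<in> I) \<and>
     (\<forall>c. \<forall>x\<in>I. c *\<^sub>C x \<in> I) \<and> (\<forall>a. \<forall>x\<in>I. a * x \<in> I \<and> x * a \<in> I)"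

definition is_maximal_ideal :: "'a::unital_cstar_algebra set \<Rightarrow> bool" where
  "is_maximal_ideal M \<longleftrightarrow> is_ideal M \<and> M \<noteq> UNIV \<and>
     (\<forall>I. is_ideal I \<and> M \<subseteq> I \<longrightarrow> I = M \<or> I = UNIV)"

definition strong_radical :: "'a::unital_cstar_algebra set" where
  "strong_radical = \<Inter> {M. is_maximal_ideal M}"

definition clinear_functional :: "('a::unital_cstar_algebra \<Rightarrow> complex) \<Rightarrow> bool" where
  "clinear_functional f \<longleftrightarrow> (\<forall>x y. f (x + y) = f x + f y) \<and> (\<forall>c x. f (c *\<^sub>C x) = c * f x)"

text \<open>Boundedness is not assumed: positive functionals are automatically bounded.\<close>

definition is_state :: "('a::unital_cstar_algebra \<Rightarrow> complex) \<Rightarrow> bool" where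
  "is_state \<omega> \<longleftrightarrow> clinear_functional \<omega> \<and> (\<forall>a. \<omega> (adj a * a) \<in> \<real>\<^sub>\<ge>\<^sub>0) \<and> \<omega> 1 = 1"

text \<open>The weak* topology is the topology of pointwise convergence on the norm dual.\<close>

definition weak_star :: "('a::unital_cstar_algebra \<Rightarrow> complex) topology" where
  "weak_star = subtopology (product_topology (\<lambda>_. euclidean) UNIV)
     {f. clinear_functional f \<and> bounded_linear f}"

definition elementary_maps :: "('a::unital_cstar_algebra \<Rightarrow> 'a) set" where
  "elementary_maps = {\<psi>. \<exists>(n::nat) a. (\<Sum>i=1..n. adj (a i) * a i) = 1 \<and>
     \<psi> = (\<lambda>x. \<Sum>i=1..n. adj (a i) * x * a i)}"

definition mixing_closure :: "('a::unital_cstar_algebra \<Rightarrow> complex) \<Rightarrow> ('a \<Rightarrow> complex) set" where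
  "mixing_closure \<omega> = weak_star closure_of {\<omega> \<circ> \<psi> |\<psi>. \<psi> \<in> elementary_maps}"

definition maximally_mixed :: "('a::unital_cstar_algebra \<Rightarrow> complex) \<Rightarrow> bool" where
  "maximally_mixed \<omega> \<longleftrightarrow> is_state \<omega> \<and>
     (\<forall>\<rho>. is_state \<rho> \<longrightarrow> \<rho> \<in> mixing_closure \<omega> \<longrightarrow> \<omega> \<in> mixing_closure \<rho>)"

definition annihilating_states :: "'a::unital_cstar_algebra set \<Rightarrow> ('a \<Rightarrow> complex) set" where
  "annihilating_states J = {\<omega>. is_state \<omega> \<and> (\<forall>x\<in>J. \<omega> x = 0)}"

end

theory Submission
  imports Defs
begin

text \<open>
  Everything rests on one way of writing \<open>1\<close>.  If a set \<open>G\<close> lies in no maximal ideal, then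
  \<open>1 = \<Sum> v\<^sup>* v\<close> with finitely many \<open>v = g y\<close>, \<open>g \<in> G\<close> (\<open>partition_of_unity\<close>): the elements
  \<open>l\<close> for which some such sum dominates \<open>l\<^sup>* l\<close> form a two-sided ideal that contains \<open>G\<close>, its
  closure is everything, hence so is the ideal itself, and a dominating sum for \<open>l = 1\<close> is
  normalised with its inverse square root.  Every such family defines an elementary map
  \<open>\<psi> x = \<Sum> v\<^sup>* x v\<close>.  When \<open>g\<close> is the positive part of a self-adjoint \<open>h\<close>, the compression
  \<open>g h g\<close> is positive, so \<open>\<psi>\<close> sees only the part of \<open>h\<close> that is positive.

  (i) Let \<open>b\<close> be a finite sum of elements \<open>x\<^sup>* x\<close> with \<open>x \<in> J\<^sub>A\<close>, and let \<open>d > 0\<close>.  Modulo a maximal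
  ideal \<open>b\<close> vanishes, so \<open>(d - b)\<^sub>+\<close> lies in no maximal ideal, and the resulting \<open>\<psi>\<close> satisfies
  \<open>\<psi> b \<le> d\<close> (\<open>mixing_small\<close>).  By compactness of the set of states the closure of
  \<open>\<omega> \<circ> E(A)\<close> contains a state \<open>\<rho>\<close> that annihilates \<open>J\<^sub>A\<close>.  If \<open>\<omega>\<close> is maximally mixed, \<open>\<omega>\<close> is in
  turn a limit of states \<open>\<rho> \<circ> \<psi>\<close>, which all annihilate \<open>J\<^sub>A\<close>.

  (ii) Let \<open>\<omega>\<close> annihilate \<open>I = M\<^sub>1 \<inter> \<dots> \<inter> M\<^sub>n\<close> and let \<open>\<rho>\<close> be in the closure of \<open>\<omega> \<circ> E(A)\<close>.  Modulo
  \<open>I\<close> the algebra is a direct sum of simple algebras, so there are elements \<open>e\<^sub>i\<close> that are, modulo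
  \<open>I\<close>, the central projections of the summands.  Elementary maps fix them modulo \<open>I\<close>, so
  \<open>\<rho> e\<^sub>i = \<omega> e\<^sub>i\<close>.  Given a self-adjoint \<open>a\<close>, let \<open>s\<^sub>i\<close> be nearly the maximum of the spectrum of
  \<open>a\<close> modulo \<open>M\<^sub>i\<close>.  Then \<open>\<omega> a\<close> is at most about \<open>\<Sum> s\<^sub>i \<omega>(e\<^sub>i)\<close>, while a partition of unity built
  from the elements \<open>(a - s\<^sub>i)\<^sub>+\<close> gives \<open>\<psi>\<close> with \<open>\<rho> (\<psi> a) \<ge> \<Sum> s\<^sub>i \<rho>(e\<^sub>i)\<close> (\<open>mixing_dominates\<close>).
  As no self-adjoint \<open>a\<close> separates \<open>\<omega>\<close> from the convex set \<open>\<rho> \<circ> E(A)\<close>, \<open>\<omega>\<close> lies in its closure.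

  Density is again a separation argument: the states annihilating a finite intersection of maximal
  ideals form a convex set of maximally mixed states.  If \<open>a\<close> separated \<open>\<omega>\<close> from it by a gap, so
  that \<open>\<omega> (-a) > s\<close> while all its states are smaller than \<open>s\<close> at \<open>-a\<close>, then
  \<open>(-a - s)\<^sub>+\<close> would lie in every maximal ideal (otherwise a Hahn-Banach argument gives a state
  annihilating \<open>M\<close> with value at least \<open>s\<close>), hence in \<open>J\<^sub>A\<close>, which forces \<open>\<omega> (-a) \<le> s\<close>.

  The facts about C*-algebras that this uses are derived directly from the axioms and without
  spectral theory.  Square roots come from a monotone iteration, and positivity of a self-adjoint
  \<open>a\<close> is characterised by \<open>\<parallel>t - a\<parallel> \<le> t\<close>.
\<close>

section \<open>The involution\<close>

lemma adj_scaleR: "adj (r *\<^sub>R x) = r *\<^sub>R adj (x :: 'a::unital_cstar_algebra)"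
  by (metis adj_scaleC scaleC_of_real complex_cnj_complex_of_real)

lemma adj_zero [simp]: "adj (0 :: 'a::unital_cstar_algebra) = 0"
  using adj_scaleR[of 0 0] by simp

lemma adj_minus: "adj (- x) = - adj (x :: 'a::unital_cstar_algebra)"
  using adj_scaleR[of "-1" x] by simp

lemma adj_diff: "adj (x - y) = adj x - adj (y :: 'a::unital_cstar_algebra)"
  using adj_add[of x "- y"] by (simp add: adj_minus)

lemma adj_one [simp]: "adj (1 :: 'a::unital_cstar_algebra) = 1"
  by (metis adj_adj adj_mult mult.right_neutral)

lemma norm_adj [simp]: "norm (adj x) = norm (x :: 'a::unital_cstar_algebra)"
proof -
  have le: "norm y \<le> norm (adj y)" for y :: 'a
  proof (cases "y = 0")
    case False
    have "norm y * norm y \<le> norm (adj y) * norm y"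
      using cstar_identity[of y] norm_mult_ineq[of "adj y" y] by (simp add: power2_eq_square)
    then show ?thesis using False by simp
  qed auto
  show ?thesis using le[of x] le[of "adj x"] by (simp add: adj_adj)
qed

lemma bounded_linear_adj: "bounded_linear (adj :: 'a::unital_cstar_algebra \<Rightarrow> 'a)"
  by (rule bounded_linear_intro[where K=1]) (auto simp: adj_add adj_scaleR)

lemmas adj_simps = adj_add adj_diff adj_minus adj_mult adj_adj adj_scaleR

lemma scaleC_i_i: "\<i> *\<^sub>C \<i> *\<^sub>C x = - (x :: 'a::unital_cstar_algebra)"
  using scaleC_of_real[of "-1" x] by (simp add: scaleC_scaleC)

lemma scaleC_zero [simp]: "c *\<^sub>C 0 = (0 :: 'a::unital_cstar_algebra)"
  using scaleC_add_right[of c 0 0] by simp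

lemma scaleC_minus_right: "c *\<^sub>C (- x) = - (c *\<^sub>C (x :: 'a::unital_cstar_algebra))"
  using scaleC_add_right[of c x "- x"] by (simp add: eq_neg_iff_add_eq_0 add.commute)

lemma scaleC_minus_left: "(- c) *\<^sub>C x = - (c *\<^sub>C (x :: 'a::unital_cstar_algebra))"
  using scaleC_add_left[of c "- c" x] scaleC_of_real[of 0 x]
  by (simp add: eq_neg_iff_add_eq_0 add.commute)

lemma scaleC_diff_right: "c *\<^sub>C (x - y) = c *\<^sub>C x - c *\<^sub>C (y :: 'a::unital_cstar_algebra)"
  using scaleC_add_right[of c x "- y"] by (simp add: scaleC_minus_right)

lemma scaleC_scaleR: "c *\<^sub>C (r *\<^sub>R x) = r *\<^sub>R (c *\<^sub>C (x :: 'a::unital_cstar_algebra))"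
  unfolding scaleC_of_real[symmetric] scaleC_scaleC by (simp add: mult.commute)

lemma norm_square_selfadjoint:
  fixes h :: "'a::unital_cstar_algebra"
  assumes "adj h = h" shows "norm (h * h) = (norm h)\<^sup>2"
  using cstar_identity[of h] assms by simp

section \<open>Square roots\<close>

text \<open>
  The fixed point equation is \<open>k = (y + k\<^sup>2) / 2\<close>, that is \<open>(1 - k)\<^sup>2 = 1 - y\<close>.  The iterates are
  polynomials in \<open>y\<close> with nonnegative coefficients, so their norms and the norms of their
  differences are bounded by the values of the same polynomials at \<open>1\<close>.  At \<open>1\<close> the iteration
  increases and stays below \<open>1\<close>, which gives convergence for all \<open>\<parallel>y\<parallel> \<le> 1\<close>, including the
  boundary case.
\<close>

primrec sqrt_iter :: "'a::real_normed_algebra_1 \<Rightarrow> nat \<Rightarrow> 'a" where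
  "sqrt_iter y 0 = 0"
| "sqrt_iter y (Suc n) = (1/2) *\<^sub>R (y + sqrt_iter y n * sqrt_iter y n)"

lemma sqrt_iter_one: "0 \<le> sqrt_iter (1::real) n \<and> sqrt_iter (1::real) n \<le> sqrt_iter 1 (Suc n) \<and> sqrt_iter (1::real) n \<le> 1"
proof (induction n)
  case (Suc n)
  then show ?case
    using mult_mono[of "sqrt_iter (1::real) n" 1 "sqrt_iter (1::real) n" 1]
      mult_mono[of "sqrt_iter (1::real) n" "sqrt_iter 1 (Suc n)" "sqrt_iter (1::real) n" "sqrt_iter 1 (Suc n)"]
    by auto
qed auto

lemma sqrt_iter_commute:
  "z * y = y * z \<Longrightarrow> z * sqrt_iter y n = sqrt_iter y n * z"
  by (induction n) (auto simp: algebra_simps, metis mult.assoc)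

lemma norm_sqrt_iter:
  fixes y :: "'a::real_normed_algebra_1"
  assumes "norm y \<le> 1" shows "norm (sqrt_iter y n) \<le> sqrt_iter 1 n"
proof (induction n)
  case (Suc n)
  have "norm (sqrt_iter y n * sqrt_iter y n) \<le> norm (sqrt_iter y n) * norm (sqrt_iter y n)"
    by (rule norm_mult_ineq)
  also have "\<dots> \<le> sqrt_iter 1 n * sqrt_iter 1 n"
    using Suc sqrt_iter_one[of n] by (intro mult_mono) auto
  finally show ?case using norm_triangle_ineq[of y "sqrt_iter y n * sqrt_iter y n"] assms by simp
qed auto

lemma norm_sqrt_iter_step:
  fixes y :: "'a::real_normed_algebra_1"
  assumes "norm y \<le> 1"
  shows "norm (sqrt_iter y (Suc n) - sqrt_iter y n) \<le> sqrt_iter 1 (Suc n) - sqrt_iter 1 n"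
proof (induction n)
  case 0
  then show ?case using assms by simp
next
  case (Suc n)
  let ?a = "sqrt_iter y (Suc n)" and ?b = "sqrt_iter y n"
  let ?r = "sqrt_iter (1::real) (Suc n)" and ?s = "sqrt_iter (1::real) n"
  have com: "?a * ?b = ?b * ?a"
    by (rule sqrt_iter_commute) (metis sqrt_iter_commute)
  have eq: "sqrt_iter y (Suc (Suc n)) - ?a = (1/2) *\<^sub>R ((?a - ?b) * (?a + ?b))"
  proof -
    have "(?a - ?b) * (?a + ?b) = ?a * ?a - ?b * ?b"
      using com by (simp add: ring_distribs del: sqrt_iter.simps)
    then have "(1/2) *\<^sub>R ((?a - ?b) * (?a + ?b)) = (1/2) *\<^sub>R (y + ?a * ?a) - (1/2) *\<^sub>R (y + ?b * ?b)"
      by (simp add: algebra_simps del: sqrt_iter.simps)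
    then show ?thesis by simp
  qed
  have "norm (?a + ?b) \<le> ?r + ?s"
    using norm_triangle_ineq[of ?a ?b] norm_sqrt_iter[OF assms, of n] norm_sqrt_iter[OF assms, of "Suc n"]
    by linarith
  then have "norm (?a - ?b) * norm (?a + ?b) \<le> (?r - ?s) * (?r + ?s)"
    using Suc sqrt_iter_one[of n] by (intro mult_mono) auto
  then have "norm ((?a - ?b) * (?a + ?b)) \<le> (?r - ?s) * (?r + ?s)"
    using norm_mult_ineq order_trans by blast
  moreover have "sqrt_iter (1::real) (Suc (Suc n)) - ?r = (1/2) * ((?r - ?s) * (?r + ?s))"
  proof -
    have "sqrt_iter (1::real) (Suc (Suc n)) - ?r = (1/2) * (1 + ?r * ?r) - (1/2) * (1 + ?s * ?s)"
      by simp
    then show ?thesis by (simp add: algebra_simps del: sqrt_iter.simps)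
  qed
  ultimately show ?case unfolding eq by (simp del: sqrt_iter.simps)
qed

lemma sqrt_iter_convergent:
  fixes y :: "'a::{real_normed_algebra_1, banach}"
  assumes "norm y \<le> 1" shows "convergent (sqrt_iter y)"
proof -
  have conv: "convergent (sqrt_iter (1::real))"
  proof (rule Bseq_mono_convergent)
    show "Bseq (sqrt_iter (1::real))"
      using sqrt_iter_one by (intro BseqI'[of _ 1]) auto
    have "incseq (sqrt_iter (1::real))"
      using sqrt_iter_one by (intro incseq_SucI) blast
    then show "\<forall>m. \<forall>n\<ge>m. sqrt_iter (1::real) m \<le> sqrt_iter 1 n"
      unfolding incseq_def by blast
  qed
  then have "summable (\<lambda>n. sqrt_iter (1::real) (Suc n) - sqrt_iter 1 n)"
    by (intro telescope_summable) (auto simp: convergent_LIMSEQ_iff simp del: sqrt_iter.simps)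
  then have "summable (\<lambda>n. sqrt_iter y (Suc n) - sqrt_iter y n)"
    by (rule summable_comparison_test'[where N=0]) (use norm_sqrt_iter_step[OF assms] in \<open>auto simp del: sqrt_iter.simps\<close>)
  then have "convergent (\<lambda>n. \<Sum>i<n. sqrt_iter y (Suc i) - sqrt_iter y i)"
    using summable_iff_convergent by blast
  then show ?thesis by (simp add: sum_lessThan_telescope del: sqrt_iter.simps(2))
qed

text \<open>
  The root lies in the bicommutant of \<open>y\<close>, and \<open>\<parallel>k\<parallel> \<le> 1\<close> allows the construction to be repeated
  for \<open>1 - k\<close>: square roots obtained in this way are squares themselves.
\<close>

lemma sqrt_one_minus:
  fixes y :: "'a::unital_cstar_algebra"
  assumes sa: "adj y = y" and y: "norm y \<le> 1"
  obtains k where "adj k = k" "norm k \<le> 1" "(1 - k) * (1 - k) = 1 - y"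
    "\<And>z. z * y = y * z \<Longrightarrow> z * k = k * z"
proof -
  obtain k where k: "sqrt_iter y \<longlonglongrightarrow> k"
    using sqrt_iter_convergent[OF y] convergent_def by blast
  have "adj (sqrt_iter y n) = sqrt_iter y n" for n
    by (induction n) (auto simp: adj_simps sa)
  then have "(\<lambda>n. adj (sqrt_iter y n)) \<longlonglongrightarrow> k" using k by simp
  then have adj_k: "adj k = k"
    using bounded_linear.tendsto[OF bounded_linear_adj k] LIMSEQ_unique by blast
  have "norm (sqrt_iter y n) \<le> 1" for n
    using norm_sqrt_iter[OF y, of n] sqrt_iter_one[of n] by linarith
  then have norm_k: "norm k \<le> 1"
    using tendsto_norm[OF k] by (intro LIMSEQ_le_const2) auto
  have "(\<lambda>n. sqrt_iter y (Suc n)) \<longlonglongrightarrow> (1/2) *\<^sub>R (y + k * k)"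
    unfolding sqrt_iter.simps by (intro tendsto_intros k)
  then have "k = (1/2) *\<^sub>R (y + k * k)"
    using k LIMSEQ_Suc LIMSEQ_unique by blast
  then have "2 *\<^sub>R k = 2 *\<^sub>R ((1/2) *\<^sub>R (y + k * k))" by metis
  then have "k + k = y + k * k" by (simp add: scaleR_2)
  then have sq: "(1 - k) * (1 - k) = 1 - y" by (simp add: algebra_simps)
  have com: "z * k = k * z" if "z * y = y * z" for z
  proof -
    have "(\<lambda>n. z * sqrt_iter y n) \<longlonglongrightarrow> z * k" "(\<lambda>n. sqrt_iter y n * z) \<longlonglongrightarrow> k * z"
      by (intro tendsto_intros k)+
    then show ?thesis using sqrt_iter_commute[OF that] LIMSEQ_unique by auto
  qed
  show ?thesis using that adj_k norm_k sq com by blast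
qed

section \<open>The positive cone\<close>

text \<open>
  Positivity as being the square of a self-adjoint element makes invariance under commuting
  products easy; closure under sums needs the equivalence with \<open>\<parallel>t - a\<parallel> \<le> t\<close> below.
\<close>

definition pos :: "'a::unital_cstar_algebra \<Rightarrow> bool" where
  "pos a \<longleftrightarrow> (\<exists>h. adj h = h \<and> a = h * h)"

lemma pos_selfadjoint: "pos a \<Longrightarrow> adj a = a"
  by (auto simp: pos_def adj_simps)

text \<open>
  Here \<open>(x + i y) / r\<close> is a unitary, because \<open>x\<close> and \<open>y\<close> commute, and \<open>x / r\<close> is its real part.  This
  is the substitute for the norm of a self-adjoint element being its spectral radius.
\<close>

lemma norm_re_part_le:
  fixes x y :: "'a::unital_cstar_algebra"
  assumes "adj x = x" "adj y = y" "x * y = y * x" "x * x + y * y = r\<^sup>2 *\<^sub>R 1" "r \<ge> 0"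
  shows "norm x \<le> r"
proof -
  define u where "u = x + \<i> *\<^sub>C y"
  have au: "adj u = x - \<i> *\<^sub>C y"
    by (simp add: u_def adj_simps adj_scaleC assms scaleC_minus_left)
  have "adj u * u = x * x + y * y"
    unfolding au unfolding u_def
    by (simp add: algebra_simps mult_scaleC_left mult_scaleC_right scaleC_i_i assms(3)
        scaleC_add_right scaleC_minus_right diff_conv_add_uminus del: add_uminus_conv_diff)
  then have "(norm u)\<^sup>2 = r\<^sup>2" using cstar_identity[of u] assms by simp
  then have nu: "norm u = r" using assms(5) by (simp add: power2_eq_iff_nonneg)
  have "x = (1/2) *\<^sub>R (u + adj u)" unfolding au by (simp add: u_def scaleR_2[symmetric])
  then have "norm x = 1/2 * norm (u + adj u)" by simp
  also have "\<dots> \<le> r" using norm_triangle_ineq[of u "adj u"] nu by simp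
  finally show ?thesis .
qed

lemma sqrt_of_norm_condition:
  fixes a :: "'a::unital_cstar_algebra"
  assumes sa: "adj a = a" and a: "norm (t *\<^sub>R 1 - a) \<le> t"
  obtains h where "adj h = h" "h * h = a" "norm (sqrt t *\<^sub>R 1 - h) \<le> sqrt t"
    "\<And>z. z * a = a * z \<Longrightarrow> z * h = h * z"
proof (cases "t = 0")
  case True
  then show ?thesis using a that[of 0] by auto
next
  case False
  then have t: "t > 0" using a norm_ge_zero[of "t *\<^sub>R 1 - a"] by linarith
  define y where "y = 1 - (1/t) *\<^sub>R a"
  have y: "y = (1/t) *\<^sub>R (t *\<^sub>R 1 - a)" using t by (simp add: y_def algebra_simps)
  have "norm y \<le> 1" unfolding y using a t by (simp add: divide_simps)
  moreover have "adj y = y" by (simp add: y_def adj_simps sa)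
  ultimately obtain k where k: "adj k = k" "norm k \<le> 1" "(1 - k) * (1 - k) = 1 - y"
    "\<And>z. z * y = y * z \<Longrightarrow> z * k = k * z" using sqrt_one_minus by blast
  define h where "h = sqrt t *\<^sub>R (1 - k)"
  have "h * h = t *\<^sub>R ((1 - k) * (1 - k))" using t by (simp add: h_def)
  then have "h * h = a" using t by (simp add: k y_def)
  moreover have "sqrt t *\<^sub>R 1 - h = sqrt t *\<^sub>R k" by (simp add: h_def algebra_simps)
  then have "norm (sqrt t *\<^sub>R 1 - h) \<le> sqrt t" using k(2) t by (simp add: mult_left_le)
  moreover have "adj h = h" by (simp add: h_def adj_simps k)
  moreover have "z * h = h * z" if "z * a = a * z" for z
    using k(4)[of z] that by (simp add: h_def y_def algebra_simps)
  ultimately show ?thesis using that by blast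
qed

text \<open>
  With \<open>k = \<surd>(t - h\<^sup>2)\<close> the equation \<open>h\<^sup>2 + k\<^sup>2 = t\<close> bounds the norm of \<open>k\<close>, not only that of \<open>h\<close>.
\<close>

lemma norm_diff_square_le:
  fixes h :: "'a::unital_cstar_algebra"
  assumes h: "adj h = h" and t: "norm (h * h) \<le> t"
  shows "norm (t *\<^sub>R 1 - h * h) \<le> t"
proof -
  have t0: "t \<ge> 0" using t norm_ge_zero[of "h * h"] by linarith
  have "norm (t *\<^sub>R 1 - (t *\<^sub>R 1 - h * h)) \<le> t" using t by simp
  moreover have "adj (t *\<^sub>R 1 - h * h) = t *\<^sub>R 1 - h * h" by (simp add: adj_simps h)
  ultimately obtain k where k: "adj k = k" "k * k = t *\<^sub>R 1 - h * h"
    "\<And>z. z * (t *\<^sub>R 1 - h * h) = (t *\<^sub>R 1 - h * h) * z \<Longrightarrow> z * k = k * z"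
    using sqrt_of_norm_condition by blast
  have "h * k = k * h" by (rule k(3)) (simp add: algebra_simps)
  then have "norm k \<le> sqrt t"
    using norm_re_part_le[of k h "sqrt t"] k(1,2) h t0 by simp
  then have "(norm k)\<^sup>2 \<le> t" using t0 by (metis norm_ge_zero power_mono real_sqrt_pow2)
  then show ?thesis using norm_square_selfadjoint[of k] k(1,2) by simp
qed

lemma pos_norm: "pos a \<Longrightarrow> norm a \<le> t \<Longrightarrow> norm (t *\<^sub>R 1 - a) \<le> t"
  unfolding pos_def by (auto intro!: norm_diff_square_le)

lemma posI: "adj a = a \<Longrightarrow> norm (t *\<^sub>R 1 - a) \<le> t \<Longrightarrow> pos a"
  unfolding pos_def by (erule (1) sqrt_of_norm_condition) (rule exI, rule conjI, assumption, erule sym)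

lemma pos_sqrt:
  fixes a :: "'a::unital_cstar_algebra"
  assumes "pos a"
  obtains h where "pos h" "h * h = a" "\<And>z. z * a = a * z \<Longrightarrow> z * h = h * z"
proof -
  have "norm (norm a *\<^sub>R 1 - a) \<le> norm a" using pos_norm[OF assms order_refl] .
  then obtain h where h: "adj h = h" "h * h = a" "norm (sqrt (norm a) *\<^sub>R 1 - h) \<le> sqrt (norm a)"
    "\<And>z. z * a = a * z \<Longrightarrow> z * h = h * z"
    using sqrt_of_norm_condition[OF pos_selfadjoint[OF assms]] by blast
  have "pos h" using posI h(1,3) by blast
  then show ?thesis using that h(2,4) by blast
qed

lemma pos_add:
  fixes a b :: "'a::unital_cstar_algebra"
  assumes "pos a" "pos b" shows "pos (a + b)"
proof (rule posI)
  show "adj (a + b) = a + b" using assms by (simp add: adj_simps pos_selfadjoint)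
  have eq: "(norm a + norm b) *\<^sub>R 1 - (a + b) = (norm a *\<^sub>R 1 - a) + (norm b *\<^sub>R 1 - b)"
    by (simp add: algebra_simps)
  show "norm ((norm a + norm b) *\<^sub>R 1 - (a + b)) \<le> norm a + norm b"
    unfolding eq using pos_norm[OF assms(1) order_refl] pos_norm[OF assms(2) order_refl]
      norm_triangle_ineq[of "norm a *\<^sub>R 1 - a" "norm b *\<^sub>R 1 - b"] by linarith
qed

lemma pos_zero [simp]: "pos 0"
  unfolding pos_def by (rule exI[of _ 0]) simp

lemma pos_scaleR: "pos a \<Longrightarrow> r \<ge> 0 \<Longrightarrow> pos (r *\<^sub>R a)"
  unfolding pos_def
proof (elim exE conjE)
  fix h assume "adj h = h" "a = h * h" "r \<ge> 0"
  then show "\<exists>h. adj h = h \<and> r *\<^sub>R a = h * h"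
    by (intro exI[of _ "sqrt r *\<^sub>R h"]) (simp add: adj_scaleR)
qed

lemma pos_one [simp]: "pos 1"
  unfolding pos_def by (rule exI[of _ 1]) simp

lemma pos_norm_minus:
  fixes a :: "'a::unital_cstar_algebra"
  assumes "adj a = a" "norm a \<le> t" shows "pos (t *\<^sub>R 1 - a)"
  by (rule posI[where t=t]) (use assms in \<open>auto simp: adj_simps\<close>)

lemma pos_commuting_mult:
  fixes a b :: "'a::unital_cstar_algebra"
  assumes "pos a" "pos b" "a * b = b * a" shows "pos (a * b)"
proof -
  obtain h where h: "pos h" "h * h = a" "\<And>z. z * a = a * z \<Longrightarrow> z * h = h * z"
    using pos_sqrt[OF assms(1)] by blast
  obtain k where k: "pos k" "k * k = b" "\<And>z. z * b = b * z \<Longrightarrow> z * k = k * z"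
    using pos_sqrt[OF assms(2)] by blast
  have "h * b = b * h" using h(3)[of b] assms(3) by simp
  then have com: "h * k = k * h" by (rule k(3))
  have "a * b = (h * k) * (h * k)"
    unfolding h(2)[symmetric] k(2)[symmetric] using com by (metis mult.assoc)
  moreover have "adj (h * k) = h * k" using com h(1) k(1) by (simp add: adj_simps pos_selfadjoint)
  ultimately show ?thesis unfolding pos_def by blast
qed

text \<open>
  The commuting product \<open>(r - x) (r + x) = r\<^sup>2 - x\<^sup>2\<close> is a square \<open>h\<^sup>2\<close>, so that \<open>x\<^sup>2 + h\<^sup>2 = r\<^sup>2\<close>.
\<close>

lemma norm_le_of_pos:
  fixes x :: "'a::unital_cstar_algebra"
  assumes "pos (r *\<^sub>R 1 - x)" "pos (r *\<^sub>R 1 + x)" "r \<ge> 0" "adj x = x"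
  shows "norm x \<le> r"
proof -
  have "pos ((r *\<^sub>R 1 - x) * (r *\<^sub>R 1 + x))"
    by (rule pos_commuting_mult) (use assms in \<open>auto simp: algebra_simps\<close>)
  then obtain h where h: "pos h" "h * h = (r *\<^sub>R 1 - x) * (r *\<^sub>R 1 + x)"
    "\<And>z. z * ((r *\<^sub>R 1 - x) * (r *\<^sub>R 1 + x)) = ((r *\<^sub>R 1 - x) * (r *\<^sub>R 1 + x)) * z \<Longrightarrow> z * h = h * z"
    using pos_sqrt by blast
  have "x * h = h * x" by (rule h(3)) (simp add: algebra_simps)
  moreover have "x * x + h * h = r\<^sup>2 *\<^sub>R 1" unfolding h(2) by (simp add: algebra_simps power2_eq_square)
  ultimately show ?thesis using norm_re_part_le assms h(1) pos_selfadjoint by blast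
qed

lemma pos_antisym: "pos a \<Longrightarrow> pos (- a) \<Longrightarrow> a = 0"
  using norm_le_of_pos[of 0 a] pos_selfadjoint[of a] by simp

lemma pos_norm_mono:
  fixes a b :: "'a::unital_cstar_algebra"
  assumes "pos a" "pos (b - a)" shows "norm a \<le> norm b"
proof (rule norm_le_of_pos)
  have "pos b" using pos_add[OF assms] by simp
  then have "pos (norm b *\<^sub>R 1 - b)" using pos_norm_minus pos_selfadjoint by blast
  then show "pos (norm b *\<^sub>R 1 - a)" using pos_add[OF _ assms(2)] by fastforce
  show "pos (norm b *\<^sub>R 1 + a)" using pos_add[OF pos_scaleR[OF pos_one] assms(1)] by simp
qed (use assms pos_selfadjoint in auto)

section \<open>Jordan decomposition\<close>

text \<open>
  The parts are \<open>(\<bar>h\<bar> \<plusminus> h) / 2\<close> with \<open>\<bar>h\<bar> = \<surd>(h\<^sup>2)\<close>.  For their cubes positivity is visible, since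
  \<open>q\<^sup>3 = q \<bar>h\<bar> q\<close> for both of them; this is enough to deduce that \<open>x\<^sup>* x\<close> is positive, and that the
  parts themselves are positive.
\<close>

lemma jordan_decomposition_cubes:
  fixes h :: "'a::unital_cstar_algebra"
  assumes h: "adj h = h"
  obtains p n where "adj p = p" "adj n = n" "h = p - n" "p * n = 0" "n * p = 0"
    "pos (p + n)" "pos (p * p * p)" "pos (n * n * n)"
    "\<And>z. z * h = h * z \<Longrightarrow> z * p = p * z" "\<And>z. z * h = h * z \<Longrightarrow> z * n = n * z"
proof -
  have "pos (h * h)" using h pos_def by blast
  then obtain d where d: "pos d" "d * d = h * h" "\<And>z. z * (h * h) = (h * h) * z \<Longrightarrow> z * d = d * z"
    using pos_sqrt by blast
  obtain k where k: "pos k" "k * k = d" "\<And>z. z * d = d * z \<Longrightarrow> z * k = k * z"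
    using pos_sqrt[OF d(1)] by blast
  have hd: "h * d = d * h" by (rule d(3)) (simp add: mult.assoc)
  have zd: "z * d = d * z" if "z * h = h * z" for z
    by (rule d(3)) (metis that mult.assoc)
  define p where "p = (1/2) *\<^sub>R (d + h)"
  define n where "n = (1/2) *\<^sub>R (d - h)"
  have sa: "adj p = p" "adj n = n"
    using pos_selfadjoint[OF d(1)] h by (simp_all add: p_def n_def adj_simps)
  have pn: "p * n = 0" "n * p = 0"
  proof -
    have "(d + h) * (d - h) = 0" "(d - h) * (d + h) = 0"
      by (simp_all add: algebra_simps hd d(2))
    then show "p * n = 0" "n * p = 0" by (simp_all add: p_def n_def)
  qed
  have sum: "p + n = d" by (simp add: p_def n_def scaleR_right_distrib[symmetric] scaleR_2[symmetric])
  have diff: "h = p - n" by (simp add: p_def n_def scaleR_right_diff_distrib[symmetric] scaleR_2[symmetric])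
  have cube: "pos (q * q * q)" if q: "adj q = q" "q * q = q * d" "q * d = d * q" for q
  proof -
    have kq: "q * k = k * q" using k(3)[OF q(3)] .
    have "q * q * q = (k * q) * (k * q)"
      using q(2) kq k(2) by (metis mult.assoc)
    moreover have "adj (k * q) = k * q" using q kq pos_selfadjoint[OF k(1)] by (simp add: adj_simps)
    ultimately show ?thesis unfolding pos_def by blast
  qed
  have "pos (p * p * p)" "pos (n * n * n)"
    by (rule cube; use sa pn in \<open>simp add: sum[symmetric] ring_distribs\<close>)+
  moreover have "z * p = p * z" "z * n = n * z" if "z * h = h * z" for z
    using zd[OF that] that by (simp_all add: p_def n_def algebra_simps)
  ultimately show ?thesis using that[of p n] sa diff pn sum d(1) by blast
qed

lemma selfadjoint_power_zero:
  fixes n :: "'a::unital_cstar_algebra"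
  assumes "adj n = n" "n * n * n * n = 0" shows "n = 0"
proof -
  have "norm ((n * n) * (n * n)) = ((norm n)\<^sup>2)\<^sup>2"
    using assms(1) by (simp add: norm_square_selfadjoint adj_simps)
  then show ?thesis using assms(2) by (simp add: mult.assoc)
qed

text \<open>
  Let \<open>n\<close> be the negative part of \<open>x\<^sup>* x\<close> and \<open>v = x n\<close>.  Then \<open>v\<^sup>* v = - r\<close> with \<open>r = n\<^sup>3\<close> positive,
  and \<open>q = v v\<^sup>*\<close> is positive because \<open>v v\<^sup>* + v\<^sup>* v\<close> is a sum of two squares.  For \<open>s = \<parallel>v\<parallel>\<^sup>2\<close> the
  relation \<open>(s + q) v = v (s - r)\<close> says that the norm of \<open>(s + q) v\<close> is at most \<open>\<parallel>v\<parallel> s\<close>, whereas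
  \<open>(s + q) q (s + q) \<ge> 2 s q\<^sup>2\<close> forces the square of this norm to be at least \<open>2 s\<^sup>3\<close>.  Hence \<open>s = 0\<close>.
\<close>

lemma pos_adj_mult:
  fixes x :: "'a::unital_cstar_algebra"
  shows "pos (adj x * x)"
proof -
  define h where "h = adj x * x"
  have sah: "adj h = h" by (simp add: h_def adj_simps)
  obtain p n where pn: "adj p = p" "adj n = n" "h = p - n" "p * n = 0" "n * p = 0"
    "pos (p + n)" "pos (n * n * n)"
    using jordan_decomposition_cubes[OF sah] by metis
  define v where "v = x * n"
  define r where "r = n * n * n"
  define q where "q = v * adj v"
  define s where "s = (norm v)\<^sup>2"
  have vv: "adj v * v = - r"
  proof -
    have "adj v * v = n * h * n" by (simp add: v_def h_def adj_simps pn(2) mult.assoc)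
    also have "\<dots> = n * p * n - n * n * n" by (simp add: pn(3) algebra_simps)
    also have "\<dots> = - r" by (simp add: pn(5) r_def)
    finally show ?thesis .
  qed
  \<comment> \<open>the real and imaginary parts of \<open>v\<close>\<close>
  define \<alpha> where "\<alpha> = (1/2) *\<^sub>R (v + adj v)"
  define \<beta> where "\<beta> = (1/2) *\<^sub>R (\<i> *\<^sub>C (adj v - v))"
  have "adj \<alpha> = \<alpha>" by (simp add: \<alpha>_def adj_simps add.commute)
  then have "pos (\<alpha> * \<alpha>)" using pos_def by blast
  have "adj \<beta> = (1/2) *\<^sub>R ((- \<i>) *\<^sub>C (- (adj v - v)))" by (simp add: \<beta>_def adj_simps adj_scaleC)
  then have "adj \<beta> = \<beta>" unfolding scaleC_minus_left scaleC_minus_right \<beta>_def by simp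
  then have "pos (\<beta> * \<beta>)" using pos_def by blast
  have aa: "\<alpha> * \<alpha> = (1/4) *\<^sub>R (v * v + v * adj v + adj v * v + adj v * adj v)"
    by (simp add: \<alpha>_def algebra_simps)
  have bb: "\<beta> * \<beta> = - (1/4) *\<^sub>R ((adj v - v) * (adj v - v))"
    by (simp add: \<beta>_def mult_scaleC_left mult_scaleC_right scaleC_scaleR scaleC_i_i)
  have sum4: "4 *\<^sub>R (\<alpha> * \<alpha>) + 4 *\<^sub>R (\<beta> * \<beta>) = 2 *\<^sub>R (v * adj v + adj v * v)"
    unfolding aa bb by (simp add: algebra_simps scaleR_2)
  have "q = 2 *\<^sub>R (\<alpha> * \<alpha>) + 2 *\<^sub>R (\<beta> * \<beta>) + r"
  proof -
    have "(1/2) *\<^sub>R (4 *\<^sub>R (\<alpha> * \<alpha>) + 4 *\<^sub>R (\<beta> * \<beta>)) = (1/2) *\<^sub>R (2 *\<^sub>R (q + adj v * v))"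
      unfolding sum4 q_def ..
    then show ?thesis by (simp add: vv scaleR_right_distrib)
  qed
  then have posq: "pos q"
    using \<open>pos (\<alpha> * \<alpha>)\<close> \<open>pos (\<beta> * \<beta>)\<close> pn(7) unfolding r_def by (auto intro!: pos_add pos_scaleR)
  have nq: "norm q = s" using cstar_identity[of "adj v"] by (simp add: q_def s_def adj_adj)
  have nr: "norm r = s" using cstar_identity[of v] by (simp add: vv s_def)
  define w where "w = (s *\<^sub>R 1 + q) * v"
  have "w = v * (s *\<^sub>R 1 - r)"
  proof -
    have "q * v = - (v * r)" unfolding q_def mult.assoc vv by simp
    then show ?thesis by (simp add: w_def algebra_simps)
  qed
  then have "norm w \<le> norm v * norm (s *\<^sub>R 1 - r)" using norm_mult_ineq by metis
  also have "\<dots> \<le> norm v * s"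
    using pos_norm[of r s] pn(7) nr by (intro mult_left_mono) (auto simp: r_def)
  finally have "(norm w)\<^sup>2 \<le> (norm v * s)\<^sup>2" by (intro power_mono) auto
  then have nw: "(norm w)\<^sup>2 \<le> s * s\<^sup>2" by (simp add: power_mult_distrib s_def)
  have "norm (w * adj w) = (norm w)\<^sup>2" using cstar_identity[of "adj w"] by (simp add: adj_adj)
  moreover have "w * adj w = (s *\<^sub>R 1 + q) * q * (s *\<^sub>R 1 + q)"
    using pos_selfadjoint[OF posq] by (simp add: w_def adj_simps q_def[symmetric] mult.assoc[symmetric])
      (simp add: q_def mult.assoc)
  moreover have "(s *\<^sub>R 1 + q) * q * (s *\<^sub>R 1 + q) = (2 * s) *\<^sub>R (q * q) + ((s * s) *\<^sub>R q + q * q * q)"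
    by (simp add: algebra_simps) (simp flip: scaleR_add_left)
  ultimately have nw': "norm ((2 * s) *\<^sub>R (q * q) + ((s * s) *\<^sub>R q + q * q * q)) = (norm w)\<^sup>2" by simp
  have posqq: "pos (q * q)" by (rule pos_commuting_mult[OF posq posq refl])
  then have "pos (q * q * q)" by (rule pos_commuting_mult[OF _ posq]) (rule mult.assoc)
  then have "pos ((s * s) *\<^sub>R q + q * q * q)" by (intro pos_add pos_scaleR[OF posq]) auto
  moreover have "pos ((2 * s) *\<^sub>R (q * q))" by (rule pos_scaleR[OF posqq]) (simp add: s_def)
  ultimately have "norm ((2 * s) *\<^sub>R (q * q)) \<le> (norm w)\<^sup>2"
    unfolding nw'[symmetric] by (intro pos_norm_mono) simp_all
  moreover have "norm ((2 * s) *\<^sub>R (q * q)) = 2 * s * s\<^sup>2"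
    using norm_square_selfadjoint[OF pos_selfadjoint[OF posq]] nq by (simp add: s_def)
  ultimately have s3: "s * s\<^sup>2 \<le> 0" using nw by linarith
  have "s = 0"
  proof (rule ccontr)
    assume "s \<noteq> 0"
    then have "s > 0" by (simp add: s_def)
    then have "s * s\<^sup>2 > 0" by simp
    then show False using s3 by simp
  qed
  then have "r = 0" using nr by simp
  then have "n = 0" using selfadjoint_power_zero[OF pn(2)] by (simp add: r_def)
  then show ?thesis using pn(3,6) by (simp add: h_def)
qed

lemma pos_conj: "pos a \<Longrightarrow> pos (adj z * a * z)"
  unfolding pos_def[of a] by (metis pos_adj_mult adj_mult mult.assoc)

text \<open>
  This applies to either part \<open>b\<close> of a decomposition with \<open>p n = n p = 0\<close>, taking \<open>y = p + n\<close>.  The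
  negative part \<open>m\<close> of \<open>b\<close> satisfies \<open>m\<^sup>4 = m b\<^sup>2 m = m b y m = - m\<^sup>3 y\<close>, which is both positive and negative.
\<close>

lemma pos_if_square_eq:
  fixes b y :: "'a::unital_cstar_algebra"
  assumes b: "adj b = b" and y: "pos y" and com: "b * y = y * b" and eq: "b * b = b * y"
  shows "pos b"
proof -
  obtain p n where pn: "adj p = p" "adj n = n" "b = p - n" "p * n = 0" "n * p = 0"
    "pos (p + n)" "pos (n * n * n)" "\<And>z. z * b = b * z \<Longrightarrow> z * n = n * z"
    using jordan_decomposition_cubes[OF b] by metis
  have yn: "y * n = n * y" by (rule pn(8)) (simp add: com)
  have nb: "n * b = - (n * n)" "b * n = - (n * n)" using pn(4,5) by (simp_all add: pn(3) ring_distribs)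
  have "n * n * n * n = (n * b) * (b * n)" unfolding nb by (simp add: mult.assoc)
  also have "\<dots> = n * (b * b) * n" by (simp add: mult.assoc)
  also have "\<dots> = (n * b) * (y * n)" unfolding eq by (simp add: mult.assoc)
  also have "\<dots> = - (n * n * n * y)" unfolding nb yn by (simp add: mult.assoc)
  finally have 1: "n * n * n * n = - (n * n * n * y)" .
  have "pos (n * n * n * y)"
    by (rule pos_commuting_mult[OF pn(7) y]) (metis yn mult.assoc)
  moreover have "pos (n * n * n * n)"
    using pos_adj_mult[of "n * n"] by (simp add: adj_simps pn(2) mult.assoc)
  ultimately have "n * n * n * n = 0" using pos_antisym[of "n * n * n * n"] 1 by simp
  then have "n = 0" by (rule selfadjoint_power_zero[OF pn(2)])
  then show ?thesis using pn(3,6) by simp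
qed

lemma jordan_decomposition:
  fixes h :: "'a::unital_cstar_algebra"
  assumes h: "adj h = h"
  obtains p n where "pos p" "pos n" "h = p - n" "p * n = 0" "n * p = 0"
proof -
  obtain p n where pn: "adj p = p" "adj n = n" "h = p - n" "p * n = 0" "n * p = 0" "pos (p + n)"
    using jordan_decomposition_cubes[OF h] by metis
  have "pos p" "pos n"
    by (rule pos_if_square_eq[where y="p + n"]; use pn in \<open>simp add: ring_distribs\<close>)+
  then show ?thesis using that pn by blast
qed

section \<open>Inverses\<close>

lemma invertible_near_one:
  fixes x :: "'a::{real_normed_algebra_1, banach}"
  assumes "norm (1 - x) < 1"
  obtains y where "y * x = 1" "x * y = 1"
proof -
  let ?z = "1 - x"
  have sm: "summable (\<lambda>n. ?z ^ n)"
    by (rule summable_comparison_test'[where N=0, OF summable_geometric[of "norm ?z"]])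
      (use assms norm_power_ineq in auto)
  define S where "S = (\<Sum>n. ?z ^ n)"
  have "S = 1 + (\<Sum>n. ?z ^ Suc n)" using suminf_split_head[OF sm] by (simp add: S_def)
  moreover have "(\<Sum>n. ?z ^ Suc n) = ?z * S"
    unfolding S_def power_Suc by (rule suminf_mult[OF sm])
  moreover have "(\<Sum>n. ?z ^ Suc n) = S * ?z"
    unfolding S_def power_Suc2 by (rule suminf_mult2[OF sm, symmetric])
  ultimately have "S = 1 + ?z * S" "S = 1 + S * ?z" by metis+
  then have "x * S = 1" "S * x = 1" by (simp_all add: algebra_simps)
  then show ?thesis using that by blast
qed

lemma inverse_sqrt:
  fixes a :: "'a::unital_cstar_algebra"
  assumes a: "pos a" and e: "e > 0"
  obtains T where "adj T = T" "T * (a + e *\<^sub>R 1) * T = 1"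
proof -
  define b where "b = a + e *\<^sub>R 1"
  define t where "t = norm a + e"
  have t: "t > 0" using e by (simp add: t_def add_nonneg_pos)
  have "1 - (1/t) *\<^sub>R b = (1/t) *\<^sub>R (norm a *\<^sub>R 1 - a)"
  proof -
    have "norm a *\<^sub>R 1 - a = t *\<^sub>R 1 - b" by (simp add: b_def t_def algebra_simps)
    then show ?thesis using t by (simp add: scaleR_right_diff_distrib)
  qed
  then have "norm (1 - (1/t) *\<^sub>R b) < 1"
    using pos_norm[OF a order_refl] t e by (simp add: t_def divide_simps)
  then obtain y' where y': "y' * ((1/t) *\<^sub>R b) = 1" "((1/t) *\<^sub>R b) * y' = 1"
    using invertible_near_one by blast
  define y where "y = (1/t) *\<^sub>R y'"
  have y: "y * b = 1" "b * y = 1" using y' by (simp_all add: y_def)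
  have "pos b" unfolding b_def using a e by (intro pos_add pos_scaleR) auto
  then obtain w where w: "pos w" "w * w = b" using pos_sqrt by blast
  define T where "T = y * w"
  have Tw: "T * w = 1" using y w by (simp add: T_def mult.assoc)
  have "w * (w * y) = 1" using y w by (simp add: mult.assoc[symmetric])
  then have "T = w * y" by (metis Tw mult.assoc mult_1_left mult_1_right)
  then have wT: "w * T = 1" using \<open>w * (w * y) = 1\<close> by simp
  have "w * adj T = 1" using arg_cong[OF Tw, of adj] pos_selfadjoint[OF w(1)] by (simp add: adj_simps)
  then have "adj T = T" by (metis Tw mult.assoc mult_1_left mult_1_right)
  moreover have "T * b * T = 1" using Tw wT w(2) by (metis mult.assoc mult_1_left)
  ultimately show ?thesis using that by (simp add: b_def)
qed

section \<open>Ideals and maximal ideals\<close>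

lemma ideal_zero: "is_ideal I \<Longrightarrow> 0 \<in> I"
  by (simp add: is_ideal_def)

lemma ideal_add: "is_ideal I \<Longrightarrow> x \<in> I \<Longrightarrow> y \<in> I \<Longrightarrow> x + y \<in> I"
  by (simp add: is_ideal_def)

lemma ideal_mult_left: "is_ideal I \<Longrightarrow> x \<in> I \<Longrightarrow> a * x \<in> I"
  by (simp add: is_ideal_def)

lemma ideal_mult_right: "is_ideal I \<Longrightarrow> x \<in> I \<Longrightarrow> x * a \<in> I"
  by (simp add: is_ideal_def)

lemma ideal_scaleR: "is_ideal I \<Longrightarrow> x \<in> I \<Longrightarrow> r *\<^sub>R x \<in> I"
  using ideal_mult_left[of I x "r *\<^sub>R 1"] by simp

lemma ideal_minus: "is_ideal I \<Longrightarrow> x \<in> I \<Longrightarrow> - x \<in> I"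
  using ideal_scaleR[of I x "-1"] by simp

lemma ideal_diff: "is_ideal I \<Longrightarrow> x \<in> I \<Longrightarrow> y \<in> I \<Longrightarrow> x - y \<in> I"
  using ideal_add[of I x "- y"] ideal_minus[of I y] by simp

lemma ideal_sum_list: "is_ideal I \<Longrightarrow> (\<And>v. v \<in> set vs \<Longrightarrow> f v \<in> I) \<Longrightarrow> (\<Sum>v\<leftarrow>vs. f v) \<in> I"
  by (induction vs) (auto simp: ideal_zero ideal_add)

lemma ideal_one: "is_ideal I \<Longrightarrow> 1 \<in> I \<Longrightarrow> I = UNIV"
  using ideal_mult_left[of I 1] by auto

lemma ideal_Inter: "(\<And>M. M \<in> \<M> \<Longrightarrow> is_ideal M) \<Longrightarrow> is_ideal (\<Inter>\<M>)"
  unfolding is_ideal_def by (auto intro!: closed_Inter)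

lemma maximal_ideal_is_ideal: "is_maximal_ideal M \<Longrightarrow> is_ideal M"
  by (simp add: is_maximal_ideal_def)

lemma maximal_ideal_one: "is_maximal_ideal M \<Longrightarrow> 1 \<notin> M"
  using ideal_one by (auto simp: is_maximal_ideal_def)

lemma maximal_ideal_subset_eq: "is_maximal_ideal M \<Longrightarrow> is_maximal_ideal N \<Longrightarrow> M \<subseteq> N \<Longrightarrow> M = N"
  unfolding is_maximal_ideal_def by blast

lemma is_ideal_closure:
  fixes H :: "'a::unital_cstar_algebra set"
  assumes "0 \<in> H" "\<And>x y. x \<in> H \<Longrightarrow> y \<in> H \<Longrightarrow> x + y \<in> H"
    "\<And>a x. x \<in> H \<Longrightarrow> a * x \<in> H" "\<And>a x. x \<in> H \<Longrightarrow> x * a \<in> H"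
  shows "is_ideal (closure H)"
proof -
  have cl: "y \<in> closure H" if "\<forall>n. g n \<in> H" "g \<longlonglongrightarrow> y" for g y
    using that unfolding closure_sequential by blast
  have add: "x + y \<in> closure H" if xy: "x \<in> closure H" "y \<in> closure H" for x y
  proof -
    obtain f where "\<forall>n. f n \<in> H" "f \<longlonglongrightarrow> x"
      using xy(1) unfolding closure_sequential by blast
    moreover obtain g where "\<forall>n. g n \<in> H" "g \<longlonglongrightarrow> y"
      using xy(2) unfolding closure_sequential by blast
    ultimately show ?thesis
      by (intro cl[of "\<lambda>n. f n + g n"]) (auto intro: assms tendsto_add)
  qed
  have mult: "a * x \<in> closure H \<and> x * a \<in> closure H" if x: "x \<in> closure H" for a x
  proof -
    obtain f where f: "\<forall>n. f n \<in> H" "f \<longlonglongrightarrow> x"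
      using x unfolding closure_sequential by blast
    have "(\<lambda>n. a * f n) \<longlonglongrightarrow> a * x" "(\<lambda>n. f n * a) \<longlonglongrightarrow> x * a" by (intro tendsto_intros f)+
    moreover have "\<forall>n. a * f n \<in> H" "\<forall>n. f n * a \<in> H" using f(1) assms(3,4) by auto
    ultimately show ?thesis using cl[of "\<lambda>n. a * f n" "a * x"] cl[of "\<lambda>n. f n * a" "x * a"] by blast
  qed
  have "c *\<^sub>C x \<in> closure H" if "x \<in> closure H" for c x
    using mult[OF that, of "c *\<^sub>C 1"] by (simp add: mult_scaleC_left)
  moreover have "0 \<in> closure H" using assms(1) closure_subset by blast
  ultimately show ?thesis using add mult by (auto simp: is_ideal_def)
qed

text \<open>
  Ideals are closed here, so a chain is bounded by the closure of its union.  The closure stays proper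
  because every proper ideal has distance at least one from \<open>1\<close>.
\<close>

lemma exists_maximal_ideal:
  fixes I :: "'a::unital_cstar_algebra set"
  assumes I: "is_ideal I" "I \<noteq> UNIV"
  obtains M where "is_maximal_ideal M" "I \<subseteq> M"
proof -
  define P where "P = {L. is_ideal L \<and> L \<noteq> UNIV \<and> I \<subseteq> L}"
  have far: "1 \<le> norm (1 - x)" if "is_ideal L" "L \<noteq> UNIV" "x \<in> L" for L and x :: 'a
  proof (rule ccontr)
    assume "\<not> 1 \<le> norm (1 - x)"
    then obtain y where "y * x = 1" using invertible_near_one[of x] by auto
    then show False using ideal_one ideal_mult_left that by metis
  qed
  have "\<exists>U\<in>P. \<forall>X\<in>C. X \<subseteq> U" if C: "subset.chain P C" for C
  proof (cases "C = {}")
    case True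
    then show ?thesis using I by (auto simp: P_def)
  next
    case False
    have CP: "L \<in> C \<Longrightarrow> is_ideal L \<and> L \<noteq> UNIV \<and> I \<subseteq> L" for L
      using C unfolding subset.chain_def P_def by auto
    have lin: "L \<in> C \<Longrightarrow> L' \<in> C \<Longrightarrow> L \<subseteq> L' \<or> L' \<subseteq> L" for L L'
      using C unfolding subset.chain_def by auto
    have "is_ideal (closure (\<Union>C))"
    proof (rule is_ideal_closure)
      show "0 \<in> \<Union>C" using False CP ideal_zero by blast
      show "x + y \<in> \<Union>C" if "x \<in> \<Union>C" "y \<in> \<Union>C" for x y
      proof -
        obtain L L' where "L \<in> C" "x \<in> L" "L' \<in> C" "y \<in> L'" using \<open>x \<in> \<Union>C\<close> \<open>y \<in> \<Union>C\<close> by blast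
        then show ?thesis using lin[of L L'] CP ideal_add by blast
      qed
    qed (use CP ideal_mult_left ideal_mult_right in blast)+
    moreover have "closure (\<Union>C) \<noteq> UNIV"
    proof
      assume "closure (\<Union>C) = UNIV"
      then have "1 \<in> closure (\<Union>C)" by simp
      then obtain x where "x \<in> \<Union>C" "dist x 1 < 1"
        unfolding closure_approachable by (meson zero_less_one)
      then obtain L where "L \<in> C" "x \<in> L" "norm (1 - x) < 1" by (auto simp: dist_norm norm_minus_commute)
      then show False using far CP by fastforce
    qed
    moreover have "I \<subseteq> closure (\<Union>C)" using False CP closure_subset[of "\<Union>C"] by blast
    ultimately show ?thesis
      using closure_subset[of "\<Union>C"] unfolding P_def by (intro bexI[of _ "closure (\<Union>C)"]) auto
  qed
  then obtain M where M: "M \<in> P" "\<forall>X\<in>P. M \<subseteq> X \<longrightarrow> X = M"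
    using subset_Zorn[of P] by blast
  have "is_maximal_ideal M"
    unfolding is_maximal_ideal_def using M unfolding P_def by blast
  then show ?thesis using that M(1) by (auto simp: P_def)
qed

lemma ideal_pos_plus:
  fixes I :: "'a::unital_cstar_algebra set"
  assumes "is_ideal I" "1 \<notin> I" "pos a" "e > 0"
  shows "a + e *\<^sub>R 1 \<notin> I"
  using inverse_sqrt[OF assms(3,4)] assms(1,2) ideal_mult_left ideal_mult_right by metis

section \<open>Partitions of unity\<close>

abbreviation sum_sq :: "'a::unital_cstar_algebra list \<Rightarrow> 'a" where
  "sum_sq vs \<equiv> (\<Sum>v\<leftarrow>vs. adj v * v)"

lemma sum_list_conj_right: "(\<Sum>v\<leftarrow>map (\<lambda>v. v * z) vs. adj v * x * v) = adj z * (\<Sum>v\<leftarrow>vs. adj v * x * v) * z"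
  by (induction vs) (auto simp: adj_simps algebra_simps)

lemma sum_sq_map_right: "sum_sq (map (\<lambda>v. v * z) vs) = adj z * sum_sq vs * z"
  using sum_list_conj_right[where x=1] by (simp add: o_def)

text \<open>
  The set \<open>H\<close> of all \<open>l\<close> with \<open>l\<^sup>* l \<le> \<Sum> v\<^sup>* v\<close> for some family of elements \<open>v \<in> G A\<close> is an ideal, up to
  closedness: sums are handled by \<open>(x + y)\<^sup>* (x + y) \<le> 2 x\<^sup>* x + 2 y\<^sup>* y\<close> and left multiples by
  \<open>a\<^sup>* a \<le> \<parallel>a\<parallel>\<^sup>2\<close>, with the factors moved into the family.  Since \<open>1 \<in> H\<close>, some family satisfies
  \<open>1 \<le> \<Sum> v\<^sup>* v\<close>, and multiplying it from the right by the inverse square root of that sum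
  stays inside \<open>G A\<close>.
\<close>

lemma partition_of_unity:
  fixes G :: "'a::unital_cstar_algebra set"
  assumes G: "\<And>M. is_maximal_ideal M \<Longrightarrow> \<not> G \<subseteq> M"
  obtains vs where "\<And>v. v \<in> set vs \<Longrightarrow> \<exists>g\<in>G. \<exists>y. v = g * y" "sum_sq vs = 1"
proof -
  define P where "P v \<longleftrightarrow> (\<exists>g\<in>G. \<exists>y. v = g * y)" for v
  define H where "H = {l. \<exists>vs. (\<forall>v\<in>set vs. P v) \<and> pos (sum_sq vs - adj l * l)}"
  have P_right: "P v \<Longrightarrow> P (v * z)" for v z unfolding P_def by (metis mult.assoc)
  have H0: "0 \<in> H" unfolding H_def by (auto intro: exI[of _ "[]"])
  have HI: "l \<in> H" if "\<forall>v\<in>set vs. P v" "pos (adj z * sum_sq vs * z - adj l * l)" for l vs z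
    unfolding H_def mem_Collect_eq using that P_right
    by (intro exI[of _ "map (\<lambda>v. v * z) vs"]) (auto simp: sum_sq_map_right[unfolded map_map o_def] o_def)
  have H_add: "x + y \<in> H" if xy: "x \<in> H" "y \<in> H" for x y
  proof -
    obtain vs ws where vw: "\<forall>v\<in>set vs. P v" "pos (sum_sq vs - adj x * x)"
      "\<forall>v\<in>set ws. P v" "pos (sum_sq ws - adj y * y)" using xy unfolding H_def by blast
    let ?z = "sqrt 2 *\<^sub>R (1::'a)"
    have "adj ?z * sum_sq (vs @ ws) * ?z - adj (x + y) * (x + y) =
      2 *\<^sub>R (sum_sq vs - adj x * x) + 2 *\<^sub>R (sum_sq ws - adj y * y) + adj (x - y) * (x - y)"
      by (simp add: adj_simps algebra_simps scaleR_2)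
    moreover have "pos \<dots>" using vw by (intro pos_add pos_scaleR pos_adj_mult) auto
    ultimately show ?thesis using vw by (intro HI[of "vs @ ws" ?z]) auto
  qed
  have H_left: "a * x \<in> H" if x: "x \<in> H" for a x
  proof -
    obtain vs where vs: "\<forall>v\<in>set vs. P v" "pos (sum_sq vs - adj x * x)" using x unfolding H_def by blast
    let ?z = "norm a *\<^sub>R (1::'a)"
    have "adj ?z * sum_sq vs * ?z - adj (a * x) * (a * x) =
      (norm a)\<^sup>2 *\<^sub>R (sum_sq vs - adj x * x) + adj x * ((norm a)\<^sup>2 *\<^sub>R 1 - adj a * a) * x"
      by (simp add: adj_simps algebra_simps power2_eq_square)
    moreover have "pos ((norm a)\<^sup>2 *\<^sub>R 1 - adj a * a)"
      by (rule pos_norm_minus) (simp_all add: adj_simps cstar_identity)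
    then have "pos (adj x * ((norm a)\<^sup>2 *\<^sub>R 1 - adj a * a) * x)" by (rule pos_conj)
    ultimately show ?thesis
      using vs by (intro HI[of vs ?z]) (auto intro!: pos_add pos_scaleR)
  qed
  have H_right: "x * a \<in> H" if x: "x \<in> H" for a x
  proof -
    obtain vs where vs: "\<forall>v\<in>set vs. P v" "pos (sum_sq vs - adj x * x)" using x unfolding H_def by blast
    have "adj a * sum_sq vs * a - adj (x * a) * (x * a) = adj a * (sum_sq vs - adj x * x) * a"
      by (simp add: adj_simps algebra_simps)
    then show ?thesis using vs pos_conj by (intro HI[of vs a]) auto
  qed
  have GH: "G \<subseteq> H"
  proof
    fix g assume "g \<in> G"
    then have "P g" unfolding P_def by (metis mult_1_right)
    then show "g \<in> H" by (intro HI[of "[g]" 1]) auto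
  qed
  have "is_ideal (closure H)" by (rule is_ideal_closure) (use H0 H_add H_left H_right in auto)
  then have "closure H = UNIV"
    using exists_maximal_ideal[of "closure H"] G GH closure_subset by (metis subset_trans)
  then have "1 \<in> closure H" by simp
  then obtain l where l: "l \<in> H" "dist l 1 < 1" unfolding closure_approachable by (meson zero_less_one)
  then have "norm (1 - l) < 1" by (simp add: dist_norm norm_minus_commute)
  then obtain y where "y * l = 1" using invertible_near_one by blast
  then have "1 \<in> H" using H_left[OF l(1)] by metis
  then obtain vs where vs: "\<forall>v\<in>set vs. P v" "pos (sum_sq vs - 1)" unfolding H_def by auto
  then obtain T where T: "adj T = T" "T * (sum_sq vs - 1 + 1 *\<^sub>R 1) * T = 1"
    using inverse_sqrt[of "sum_sq vs - 1" 1] by auto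
  have "sum_sq (map (\<lambda>v. v * T) vs) = 1" unfolding sum_sq_map_right using T by simp
  moreover have "\<exists>g\<in>G. \<exists>y. v = g * y" if "v \<in> set (map (\<lambda>v. v * T) vs)" for v
    using that vs P_right unfolding P_def[symmetric] by auto
  ultimately show ?thesis using that by blast
qed

text \<open>
  A partition of unity from \<open>M \<union> N\<close> splits \<open>x \<in> I\<close> into terms \<open>x v\<^sup>* v\<close> that lie in \<open>N\<close> or in \<open>I \<inter> M\<close>.
\<close>

lemma inter_maximal_subset:
  fixes I :: "'a::unital_cstar_algebra set"
  assumes I: "is_ideal I" and M: "is_maximal_ideal M" and N: "is_maximal_ideal N"
    and MN: "M \<noteq> N" and sub: "I \<inter> M \<subseteq> N"
  shows "I \<subseteq> N"
proof
  fix x assume x: "x \<in> I"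
  have "\<not> M \<union> N \<subseteq> K" if "is_maximal_ideal K" for K
    using maximal_ideal_subset_eq M N MN that by blast
  then obtain vs where vs: "\<And>v. v \<in> set vs \<Longrightarrow> \<exists>g\<in>M \<union> N. \<exists>y. v = g * y" "sum_sq vs = 1"
    using partition_of_unity by blast
  have "x * adj v * v \<in> N" if v: "v \<in> set vs" for v
  proof -
    consider "v \<in> M" | "v \<in> N" using vs(1)[OF v] M N maximal_ideal_is_ideal ideal_mult_right by blast
    then show ?thesis
    proof cases
      case 1
      then have "x * adj v * v \<in> I \<inter> M"
        using I x M maximal_ideal_is_ideal ideal_mult_right ideal_mult_left by (metis IntI)
      then show ?thesis using sub by blast
    next
      case 2
      then show ?thesis using N maximal_ideal_is_ideal ideal_mult_left by blast
    qed
  qed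
  then have "(\<Sum>v\<leftarrow>vs. x * adj v * v) \<in> N" by (intro ideal_sum_list maximal_ideal_is_ideal N)
  moreover have "(\<Sum>v\<leftarrow>vs. x * adj v * v) = x * sum_sq vs"
    by (simp add: sum_list_const_mult mult.assoc)
  ultimately show "x \<in> N" by (simp add: vs(2))
qed

lemma Inter_maximal_subset:
  fixes \<M> :: "'a::unital_cstar_algebra set set"
  assumes "finite \<M>" "\<And>M. M \<in> \<M> \<Longrightarrow> is_maximal_ideal M" "is_maximal_ideal N" "\<Inter>\<M> \<subseteq> N"
  shows "N \<in> \<M>"
  using assms
proof (induction \<M>)
  case empty
  then show ?case using maximal_ideal_one by auto
next
  case (insert M \<M>)
  show ?case
  proof (cases "M = N")
    case False
    have "is_ideal (\<Inter>\<M>)" using insert.prems(1) maximal_ideal_is_ideal by (intro ideal_Inter) auto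
    then have "\<Inter>\<M> \<subseteq> N"
      using insert.prems False by (intro inter_maximal_subset[of "\<Inter>\<M>" M N]) auto
    then show ?thesis using insert by auto
  qed auto
qed

text \<open>
  If \<open>c A z \<subseteq> M\<close> then each \<open>v\<close> of a partition of unity from \<open>{c} \<union> M\<close> has \<open>v z \<in> M\<close>, and so
  \<open>z = \<Sum> v\<^sup>* v z\<close> lies in \<open>M\<close>.
\<close>

lemma maximal_ideal_prime:
  fixes c z :: "'a::unital_cstar_algebra"
  assumes M: "is_maximal_ideal M" and c: "c \<notin> M" and z: "z \<notin> M"
  obtains y where "c * y * z \<notin> M"
proof -
  have "\<not> insert c M \<subseteq> K" if "is_maximal_ideal K" for K
    using maximal_ideal_subset_eq M c that by blast
  then obtain vs where vs: "\<And>v. v \<in> set vs \<Longrightarrow> \<exists>g\<in>insert c M. \<exists>y. v = g * y" "sum_sq vs = 1"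
    using partition_of_unity by blast
  have "\<exists>y. c * y * z \<notin> M"
  proof (rule ccontr)
    assume "\<nexists>y. c * y * z \<notin> M"
    then have all: "c * y * z \<in> M" for y by blast
    have vz: "v * z \<in> M" if v: "v \<in> set vs" for v
      using vs(1)[OF v] all M maximal_ideal_is_ideal ideal_mult_right by blast
    have "(\<Sum>v\<leftarrow>vs. adj v * (v * z)) \<in> M"
      by (intro ideal_sum_list ideal_mult_left maximal_ideal_is_ideal M vz)
    moreover have "(\<Sum>v\<leftarrow>vs. adj v * (v * z)) = sum_sq vs * z"
      by (simp add: sum_list_mult_const flip: mult.assoc)
    ultimately show False using vs(2) z by simp
  qed
  then show ?thesis using that by blast
qed

section \<open>Positive parts and ideals\<close>

definition pos_part :: "'a::unital_cstar_algebra \<Rightarrow> 'a" where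
  "pos_part h = (SOME p. \<exists>n. pos p \<and> pos n \<and> h = p - n \<and> p * n = 0 \<and> n * p = 0)"

lemma pos_part:
  fixes h :: "'a::unital_cstar_algebra"
  assumes "adj h = h"
  shows "pos (pos_part h)" "pos (pos_part h - h)" "pos_part h * (pos_part h - h) = 0"
    "pos (pos_part h * h * pos_part h)"
proof -
  have "\<exists>p n. pos p \<and> pos n \<and> h = p - n \<and> p * n = 0 \<and> n * p = 0"
    using jordan_decomposition[OF assms] by metis
  then have "\<exists>n. pos (pos_part h) \<and> pos n \<and> h = pos_part h - n \<and> pos_part h * n = 0 \<and> n * pos_part h = 0"
    unfolding pos_part_def by (rule someI_ex)
  then obtain n where n: "pos (pos_part h)" "pos n" "h = pos_part h - n" "pos_part h * n = 0" by blast
  then show "pos (pos_part h)" by simp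
  have d: "pos_part h - h = n" using n(3) by (metis add_diff_cancel_left' diff_add_cancel)
  show "pos (pos_part h - h)" "pos_part h * (pos_part h - h) = 0" unfolding d by (fact n)+
  have "pos_part h * h = pos_part h * pos_part h" using n(3,4) by (metis diff_zero right_diff_distrib)
  moreover have "pos (pos_part h * pos_part h * pos_part h)"
    using n(1) by (intro pos_commuting_mult) (auto simp: mult.assoc)
  ultimately show "pos (pos_part h * h * pos_part h)" by simp
qed

lemma pos_part_eq_zero:
  fixes h :: "'a::unital_cstar_algebra"
  assumes "pos (- h)" shows "pos_part h = 0"
proof -
  have sa: "adj h = h" using pos_selfadjoint[OF assms] by (simp add: adj_minus)
  define p where "p = pos_part h"
  have p: "pos p" "p * (p - h) = 0" using pos_part[OF sa] by (simp_all add: p_def)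
  have sap: "adj p = p" using p(1) by (rule pos_selfadjoint)
  have ph: "p * h = p * p" using p(2) by (simp add: algebra_simps)
  have "pos (adj p * (- h) * p)" by (rule pos_conj[OF assms])
  then have "pos (- (p * p * p))" by (simp add: sap ph)
  moreover have "pos (p * p * p)"
    using p(1) by (intro pos_commuting_mult) (auto simp: mult.assoc)
  ultimately have "p * p * p = 0" using pos_antisym by blast
  then have "p = 0" by (intro selfadjoint_power_zero[OF sap]) simp
  then show ?thesis by (simp add: p_def)
qed

lemma pos_part_notin_ideal:
  fixes I :: "'a::unital_cstar_algebra set"
  assumes "is_ideal I" "1 \<notin> I" "adj h = h" "pos (h - e *\<^sub>R 1)" "e > 0"
  shows "pos_part h \<notin> I"
proof -
  have "pos ((pos_part h - h) + (h - e *\<^sub>R 1))" using assms pos_part by (intro pos_add) auto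
  then show ?thesis using ideal_pos_plus[OF assms(1,2) _ assms(5)] by fastforce
qed

text \<open>
  The number \<open>s\<close> approximates the maximum of the spectrum of \<open>a\<close> modulo \<open>M\<close> within \<open>d\<close>.  It is
  the last point, on the grid of mesh \<open>d\<close> from \<open>- \<parallel>a\<parallel> - 1\<close> on, before the positive part of \<open>a - s\<close>
  first falls into \<open>M\<close>.
\<close>

lemma spectral_threshold:
  fixes M :: "'a::unital_cstar_algebra set"
  assumes M: "is_ideal M" "1 \<notin> M" and a: "adj a = a" and d: "d > 0"
  obtains s where "pos_part (a - s *\<^sub>R 1) \<notin> M" "pos_part (a - (s + d) *\<^sub>R 1) \<in> M"
proof -
  define f where "f k = a - (- norm a - 1 + real k * d) *\<^sub>R 1" for k
  obtain k where "real k * d > 2 * norm a + 1" using d reals_Archimedean3 by blast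
  then have k: "norm a \<le> - norm a - 1 + real k * d" by linarith
  then have "pos (- f k)" using pos_norm_minus[OF a k] by (simp add: f_def)
  then have fk: "pos_part (f k) \<in> M" using pos_part_eq_zero ideal_zero[OF M(1)] by metis
  have f0: "pos_part (f 0) \<notin> M"
  proof (rule pos_part_notin_ideal[OF M])
    show "adj (f 0) = f 0" using a by (simp add: f_def adj_simps)
    have "pos (norm a *\<^sub>R 1 - (- a))" by (rule pos_norm_minus) (use a in \<open>auto simp: adj_simps\<close>)
    then show "pos (f 0 - 1 *\<^sub>R 1)" by (simp add: f_def algebra_simps)
  qed simp
  define m where "m = (LEAST k. pos_part (f k) \<in> M)"
  have m: "pos_part (f m) \<in> M" unfolding m_def by (rule LeastI[of "\<lambda>k. pos_part (f k) \<in> M", OF fk])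
  then obtain j where j: "m = Suc j" using f0 by (cases m) auto
  then have "pos_part (f j) \<notin> M"
    using not_less_Least[of j "\<lambda>k. pos_part (f k) \<in> M"] unfolding m_def by auto
  then show ?thesis using m that[of "- norm a - 1 + real j * d"] unfolding j f_def
    by (simp add: algebra_simps)
qed

section \<open>States\<close>

lemma state_add: "is_state \<omega> \<Longrightarrow> \<omega> (x + y) = \<omega> x + \<omega> y"
  by (simp add: is_state_def clinear_functional_def)

lemma state_scaleC: "is_state \<omega> \<Longrightarrow> \<omega> (c *\<^sub>C x) = c * \<omega> x"
  by (simp add: is_state_def clinear_functional_def)

lemma state_scaleR: "is_state \<omega> \<Longrightarrow> \<omega> (r *\<^sub>R x) = complex_of_real r * \<omega> x"
  using state_scaleC[of \<omega> "complex_of_real r" x] by (simp add: scaleC_of_real)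

lemma state_zero: "is_state \<omega> \<Longrightarrow> \<omega> 0 = 0"
  using state_scaleR[of \<omega> 0 0] by simp

lemma state_minus: "is_state \<omega> \<Longrightarrow> \<omega> (- x) = - \<omega> x"
  using state_scaleR[of \<omega> "-1" x] by simp

lemma state_diff: "is_state \<omega> \<Longrightarrow> \<omega> (x - y) = \<omega> x - \<omega> y"
  using state_add[of \<omega> x "- y"] state_minus[of \<omega> y] by simp

lemma state_one: "is_state \<omega> \<Longrightarrow> \<omega> 1 = 1"
  by (simp add: is_state_def)

lemmas state_linear = state_add state_diff state_minus state_scaleR state_scaleC state_zero state_one

lemma state_sum: "is_state \<omega> \<Longrightarrow> \<omega> (\<Sum>v\<in>V. f v) = (\<Sum>v\<in>V. \<omega> (f v))"
  by (induction V rule: infinite_finite_induct) (simp_all add: state_linear)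

lemma state_pos: "is_state \<omega> \<Longrightarrow> pos a \<Longrightarrow> 0 \<le> Re (\<omega> a) \<and> Im (\<omega> a) = 0"
  unfolding pos_def is_state_def complex_nonneg_Reals_iff by metis

lemma state_mono: "is_state \<omega> \<Longrightarrow> pos (b - a) \<Longrightarrow> Re (\<omega> a) \<le> Re (\<omega> b)"
  using state_pos[of \<omega> "b - a"] by (simp add: state_linear)

lemma state_selfadjoint:
  assumes "is_state \<omega>" "adj a = a" shows "Im (\<omega> a) = 0"
  using state_pos[OF assms(1) pos_norm_minus[OF assms(2) order_refl]] assms(1) by (simp add: state_linear)

lemma state_adj:
  assumes w: "is_state \<omega>" shows "\<omega> (adj x) = cnj (\<omega> x)"
proof -
  have "Im (\<omega> (x + adj x)) = 0"
    by (rule state_selfadjoint[OF w]) (simp add: adj_simps add.commute)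
  moreover have "adj (\<i> *\<^sub>C (x - adj x)) = \<i> *\<^sub>C (x - adj x)"
  proof -
    have "adj (\<i> *\<^sub>C (x - adj x)) = (- \<i>) *\<^sub>C (- (x - adj x))" by (simp add: adj_simps adj_scaleC)
    then show ?thesis by (simp only: scaleC_minus_left scaleC_minus_right minus_minus)
  qed
  then have "Im (\<omega> (\<i> *\<^sub>C (x - adj x))) = 0"
    by (rule state_selfadjoint[OF w])
  ultimately show ?thesis using w by (simp add: state_linear complex_eq_iff)
qed

text \<open>
  This is positivity of \<open>\<omega>\<close> at \<open>y\<^sup>* y\<close> for \<open>y = x - \<omega>(x) 1\<close>.
\<close>

lemma state_cauchy_schwarz:
  assumes w: "is_state \<omega>" shows "(cmod (\<omega> x))\<^sup>2 \<le> Re (\<omega> (adj x * x))"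
proof -
  let ?l = "\<omega> x"
  let ?y = "x - ?l *\<^sub>C 1"
  have "adj ?y * ?y = adj x * x - ?l *\<^sub>C adj x - cnj ?l *\<^sub>C x + (cnj ?l * ?l) *\<^sub>C 1"
    by (simp add: adj_simps adj_scaleC algebra_simps mult_scaleC_left mult_scaleC_right scaleC_scaleC scaleC_diff_right)
  then have "\<omega> (adj ?y * ?y) = \<omega> (adj x * x) - cnj ?l * ?l"
    using w by (simp add: state_linear state_adj)
  moreover have "0 \<le> Re (\<omega> (adj ?y * ?y))" using state_pos[OF w pos_adj_mult] by blast
  moreover have "Re (cnj ?l * ?l) = (cmod ?l)\<^sup>2" by (simp only: cmod_power2) (simp add: power2_eq_square)
  ultimately show ?thesis by simp
qed

lemma state_zero_of_square_zero:
  assumes "is_state \<omega>" "\<omega> (adj x * x) = 0" shows "\<omega> x = 0"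
  using state_cauchy_schwarz[OF assms(1), of x] assms(2) by simp

lemma state_norm_le:
  assumes w: "is_state \<omega>" shows "cmod (\<omega> x) \<le> norm x"
proof -
  have "pos ((norm x)\<^sup>2 *\<^sub>R 1 - adj x * x)"
    by (rule pos_norm_minus) (simp_all add: adj_simps cstar_identity)
  then have "Re (\<omega> (adj x * x)) \<le> (norm x)\<^sup>2" using state_mono[OF w] w by (fastforce simp: state_linear)
  then have "(cmod (\<omega> x))\<^sup>2 \<le> (norm x)\<^sup>2" using state_cauchy_schwarz[OF w, of x] by linarith
  then show ?thesis by (rule power2_le_imp_le) simp
qed

lemma state_bounded_linear: "is_state \<omega> \<Longrightarrow> bounded_linear \<omega>"
  by (rule bounded_linear_intro[where K=1])
    (simp_all add: state_add state_scaleR state_norm_le scaleR_conv_of_real[where 'a=complex])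

section \<open>Weak* topology on states\<close>

lemma closed_states: "closed {\<omega> :: 'a::unital_cstar_algebra \<Rightarrow> complex. is_state \<omega>}"
proof -
  have eval: "continuous_on UNIV (\<lambda>f :: 'a \<Rightarrow> complex. f x)" for x
    by (rule continuous_on_product_coordinates)
  have *: "{\<omega> :: 'a \<Rightarrow> complex. is_state \<omega>} =
      ({\<omega>. \<forall>x y. \<omega> (x + y) = \<omega> x + \<omega> y} \<inter> {\<omega>. \<forall>c x. \<omega> (c *\<^sub>C x) = c * \<omega> x}) \<inter>
      {\<omega>. \<forall>a. \<omega> (adj a * a) \<in> \<real>\<^sub>\<ge>\<^sub>0} \<inter> {\<omega>. \<omega> 1 = 1}"
    by (auto simp: is_state_def clinear_functional_def)
  have "closed {\<omega> :: 'a \<Rightarrow> complex. \<omega> (adj a * a) \<in> \<real>\<^sub>\<ge>\<^sub>0}" for a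
    using closed_vimage[OF closed_nonneg_Reals_complex eval[of "adj a * a"]] by (simp add: vimage_def)
  then show ?thesis
    unfolding * by (intro closed_Int closed_Collect_all closed_Collect_eq continuous_intros eval) auto
qed

lemma compact_states: "compact {\<omega> :: 'a::unital_cstar_algebra \<Rightarrow> complex. is_state \<omega>}"
proof -
  let ?B = "PiE UNIV (\<lambda>x :: 'a. cball (0 :: complex) (norm x))"
  have "compactin (product_topology (\<lambda>_ :: 'a. euclidean :: complex topology) UNIV) ?B"
    by (simp add: compactin_PiE)
  then have "compact ?B" by (simp add: euclidean_product_topology)
  then have "compact (?B \<inter> {\<omega>. is_state \<omega>})" using closed_states by (rule compact_Int_closed)
  moreover have "?B \<inter> {\<omega>. is_state \<omega>} = {\<omega> :: 'a \<Rightarrow> complex. is_state \<omega>}"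
    by (auto simp: state_norm_le)
  ultimately show ?thesis by simp
qed

lemma closure_states_subset:
  "T \<subseteq> {\<omega> :: 'a::unital_cstar_algebra \<Rightarrow> complex. is_state \<omega>} \<Longrightarrow> closure T \<subseteq> {\<omega>. is_state \<omega>}"
  using closed_states closure_minimal by blast

lemma compact_closure_states:
  assumes "T \<subseteq> {\<omega> :: 'a::unital_cstar_algebra \<Rightarrow> complex. is_state \<omega>}"
  shows "compact (closure T)"
proof -
  have "compact (closure T \<inter> {\<omega>. is_state \<omega>})"
    by (rule closed_Int_compact[OF closed_closure compact_states])
  then show ?thesis using closure_states_subset[OF assms] by (simp add: Int_absorb2)
qed

text \<open>
  Limits of states in the product topology are again states, hence bounded, so the restriction to the
  norm dual does not change closures of sets of states.
\<close>

lemma weak_star_closure_of_states: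
  fixes T :: "('a::unital_cstar_algebra \<Rightarrow> complex) set"
  assumes T: "T \<subseteq> {\<omega>. is_state \<omega>}"
  shows "weak_star closure_of T = closure T"
proof -
  let ?B = "{f :: 'a \<Rightarrow> complex. clinear_functional f \<and> bounded_linear f}"
  have SB: "{\<omega>. is_state \<omega>} \<subseteq> ?B" using state_bounded_linear by (auto simp: is_state_def)
  have "weak_star closure_of T = ?B \<inter> closure (?B \<inter> T)"
    unfolding weak_star_def closure_of_subtopology by (simp add: euclidean_product_topology)
  moreover have "?B \<inter> T = T" using SB T by blast
  ultimately show ?thesis using closure_states_subset[OF T] SB by auto
qed

lemma closure_pointwise:
  fixes T :: "('a \<Rightarrow> complex) set"
  shows "f \<in> closure T \<longleftrightarrow> (\<forall>X e. finite X \<longrightarrow> e > 0 \<longrightarrow> (\<exists>g\<in>T. \<forall>x\<in>X. cmod (g x - f x) < e))"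
    (is "?L \<longleftrightarrow> ?R")
proof
  assume f: ?L
  show ?R
  proof (intro allI impI)
    fix X :: "'a set" and e :: real
    assume X: "finite X" "e > 0"
    define U where "U = (\<Inter>x\<in>X. (\<lambda>g :: 'a \<Rightarrow> complex. g x) -` ball (f x) e)"
    have "open U" unfolding U_def
      using X by (intro open_INT ballI open_vimage open_ball continuous_on_product_coordinates)
    moreover have "f \<in> U" using X by (auto simp: U_def)
    ultimately have "U \<inter> T \<noteq> {}" using open_Int_closure_eq_empty[of U T] f by blast
    then obtain g where "g \<in> T" "g \<in> U" by blast
    then show "\<exists>g\<in>T. \<forall>x\<in>X. cmod (g x - f x) < e"
      by (intro bexI[of _ g]) (auto simp: U_def dist_norm norm_minus_commute)
  qed
next
  assume R: ?R
  show ?L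
  proof (rule ccontr)
    assume "f \<notin> closure T"
    moreover have "openin (product_topology (\<lambda>_. euclidean) UNIV) (- closure T)"
      unfolding euclidean_product_topology by (simp add: open_Compl)
    ultimately obtain V where V: "f \<in> PiE UNIV V" "\<And>i. open (V i)" "finite {i. V i \<noteq> UNIV}"
      "PiE UNIV V \<subseteq> - closure T"
      using product_topology_open_contains_basis[of "\<lambda>_. euclidean" UNIV "- closure T" f] by auto
    let ?X = "{i. V i \<noteq> UNIV}"
    have "\<exists>e>0. ball (f i) e \<subseteq> V i" for i
      using V(1,2) open_contains_ball by blast
    then obtain r where r: "\<And>i. r i > 0" "\<And>i. ball (f i) (r i) \<subseteq> V i" by metis
    define e where "e = Min (insert 1 (r ` ?X))"
    have "e > 0" using V(3) r by (simp add: e_def)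
    then obtain g where g: "g \<in> T" "\<forall>x\<in>?X. cmod (g x - f x) < e" using R V(3) by blast
    have "g i \<in> V i" for i
    proof (cases "i \<in> ?X")
      case True
      then have "e \<le> r i" using V(3) by (simp add: e_def)
      moreover have "cmod (g i - f i) < e" using g(2) True by blast
      ultimately have "g i \<in> ball (f i) (r i)" by (simp add: dist_norm norm_minus_commute)
      then show ?thesis using r(2) by blast
    qed auto
    then have "g \<in> PiE UNIV V" by (simp add: PiE_def extensional_def)
    then show False using V(4) g(1) closure_subset by blast
  qed
qed

lemma closure_eq_value:
  fixes T :: "('a \<Rightarrow> complex) set"
  assumes "f \<in> closure T" "\<And>g. g \<in> T \<Longrightarrow> g x = c" shows "f x = c"
proof (rule ccontr)
  assume ne: "f x \<noteq> c"
  have "finite {x}" "cmod (c - f x) > 0" using ne by auto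
  then obtain g where "g \<in> T" "\<forall>y\<in>{x}. cmod (g y - f y) < cmod (c - f x)"
    using assms(1) unfolding closure_pointwise by blast
  then show False using assms(2) by auto
qed

section \<open>Elementary maps and mixing\<close>

lemma elementary_mapI:
  fixes vs :: "'a::unital_cstar_algebra list"
  assumes "sum_sq vs = 1"
  shows "(\<lambda>x. \<Sum>v\<leftarrow>vs. adj v * x * v) \<in> elementary_maps"
proof -
  have eq: "(\<Sum>v\<leftarrow>vs. f v) = (\<Sum>i=1..length vs. f (vs ! (i - 1)))" for f :: "'a \<Rightarrow> 'a"
    by (simp add: sum_list_sum_nth atLeast0LessThan sum.atLeast1_atMost_eq)
  show ?thesis unfolding elementary_maps_def mem_Collect_eq
    using assms unfolding eq by (intro exI[of _ "length vs"] exI[of _ "\<lambda>i. vs ! (i - 1)"]) auto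
qed

lemma elementary_mapE:
  fixes \<psi> :: "'a::unital_cstar_algebra \<Rightarrow> 'a"
  assumes "\<psi> \<in> elementary_maps"
  obtains vs where "sum_sq vs = 1" "\<psi> = (\<lambda>x. \<Sum>v\<leftarrow>vs. adj v * x * v)"
proof -
  obtain n and a :: "nat \<Rightarrow> 'a" where na: "(\<Sum>i=1..n. adj (a i) * a i) = 1"
    "\<psi> = (\<lambda>x. \<Sum>i=1..n. adj (a i) * x * a i)"
    using assms unfolding elementary_maps_def by blast
  have eq: "(\<Sum>v\<leftarrow>map a [1..<Suc n]. f v) = (\<Sum>i=1..n. f (a i))" for f :: "'a \<Rightarrow> 'a"
    by (simp add: interv_sum_list_conv_sum_set_nat o_def atLeastLessThanSuc_atLeastAtMost del: upt_Suc)
  show ?thesis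
    by (rule that[of "map a [1..<Suc n]"]) (use na in \<open>simp_all only: eq\<close>)
qed

lemma pos_sum_list: "(\<And>v. v \<in> set vs \<Longrightarrow> pos (f v)) \<Longrightarrow> pos (\<Sum>v\<leftarrow>vs. f v)"
  by (induction vs) (auto intro: pos_add)

lemma state_elementary:
  assumes w: "is_state \<omega>" and psi: "\<psi> \<in> elementary_maps"
  shows "is_state (\<omega> \<circ> \<psi>)"
proof -
  obtain vs where vs: "sum_sq vs = 1" "\<psi> = (\<lambda>x. \<Sum>v\<leftarrow>vs. adj v * x * v)"
    using elementary_mapE[OF psi] by blast
  have lin: "\<psi> (x + y) = \<psi> x + \<psi> y" "\<psi> (c *\<^sub>C x) = c *\<^sub>C \<psi> x" for x y c
    unfolding vs(2) by (induction vs) (auto simp: algebra_simps mult_scaleC_left mult_scaleC_right scaleC_add_right)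
  have "pos (\<psi> (adj a * a))" for a
    unfolding vs(2) by (intro pos_sum_list pos_conj pos_adj_mult)
  moreover have "\<psi> 1 = 1" using vs by simp
  ultimately show ?thesis
    using w state_pos[OF w] lin
    by (auto simp: is_state_def[of "\<omega> \<circ> \<psi>"] clinear_functional_def state_linear complex_nonneg_Reals_iff)
qed

lemma mixing_closure_eq:
  assumes "is_state \<omega>"
  shows "mixing_closure \<omega> = closure {\<omega> \<circ> \<psi> |\<psi>. \<psi> \<in> elementary_maps}"
  unfolding mixing_closure_def
  by (rule weak_star_closure_of_states) (use assms state_elementary in blast)

text \<open>
  With \<open>h = d - \<Sum> x\<^sup>* x\<close> and \<open>c = h\<^sub>+\<close>: modulo a maximal ideal \<open>M\<close> the element \<open>h\<close> is the
  scalar \<open>d\<close>, so \<open>c \<in> M\<close> would put \<open>(c - h) + d\<close>, which is invertible, into \<open>M\<close>.  The map built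
  from a partition of unity over \<open>c\<close> sends \<open>h\<close> to a positive element.
\<close>

lemma mixing_small:
  fixes xs :: "'a::unital_cstar_algebra list"
  assumes xs: "set xs \<subseteq> strong_radical" and d: "d > 0"
  obtains \<psi> where "\<psi> \<in> elementary_maps"
    "\<And>\<omega> x. is_state \<omega> \<Longrightarrow> x \<in> set xs \<Longrightarrow> Re (\<omega> (\<psi> (adj x * x))) \<le> d"
proof -
  define b where "b = sum_sq xs"
  define h where "h = d *\<^sub>R 1 - b"
  define c where "c = pos_part h"
  have "pos b" unfolding b_def by (intro pos_sum_list pos_adj_mult)
  then have "adj h = h" by (simp add: h_def adj_simps pos_selfadjoint)
  then have c: "pos c" "pos (c - h)" "pos (c * h * c)" using pos_part by (auto simp: c_def)
  have "\<not> {c} \<subseteq> M" if M: "is_maximal_ideal M" for M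
  proof
    assume "{c} \<subseteq> M"
    moreover have "b \<in> M"
      unfolding b_def using xs M by (intro ideal_sum_list ideal_mult_left maximal_ideal_is_ideal) (auto simp: strong_radical_def)
    ultimately have "c + b \<in> M" using ideal_add maximal_ideal_is_ideal[OF M] by blast
    moreover have "c + b = (c - h) + d *\<^sub>R 1" by (simp add: h_def)
    ultimately show False
      using ideal_pos_plus[OF maximal_ideal_is_ideal[OF M] maximal_ideal_one[OF M] c(2) d] by simp
  qed
  then obtain vs where vs: "\<And>v. v \<in> set vs \<Longrightarrow> \<exists>g\<in>{c}. \<exists>y. v = g * y" "sum_sq vs = 1"
    using partition_of_unity by blast
  define \<psi> where "\<psi> = (\<lambda>x. \<Sum>v\<leftarrow>vs. adj v * x * v)"
  have psi: "\<psi> \<in> elementary_maps" unfolding \<psi>_def by (rule elementary_mapI[OF vs(2)])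
  have "pos (adj v * h * v)" if v: "v \<in> set vs" for v
  proof -
    obtain y where "v = c * y" using vs(1)[OF v] by blast
    then have "adj v * h * v = adj y * (c * h * c) * y"
      using pos_selfadjoint[OF c(1)] by (simp add: adj_simps mult.assoc)
    then show ?thesis using pos_conj[OF c(3)] by simp
  qed
  then have ph: "pos (\<psi> h)" unfolding \<psi>_def by (rule pos_sum_list)
  have "Re (\<omega> (\<psi> (adj x * x))) \<le> d" if w: "is_state \<omega>" and x: "x \<in> set xs" for \<omega> x
  proof -
    have wp: "is_state (\<omega> \<circ> \<psi>)" by (rule state_elementary[OF w psi])
    have "pos (b - adj x * x)"
    proof -
      have "b - adj x * x = sum_sq (remove1 x xs)"
        unfolding b_def sum_list_map_remove1[OF x, of "\<lambda>v. adj v * v"] by simp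
      then show ?thesis by (simp add: pos_sum_list pos_adj_mult)
    qed
    then have "Re ((\<omega> \<circ> \<psi>) (adj x * x)) \<le> Re ((\<omega> \<circ> \<psi>) b)" by (rule state_mono[OF wp])
    moreover have "0 \<le> Re ((\<omega> \<circ> \<psi>) h)" using state_pos[OF w ph] by simp
    then have "Re ((\<omega> \<circ> \<psi>) b) \<le> d"
      unfolding h_def by (simp only: state_linear[OF wp]) simp
    ultimately show ?thesis by simp
  qed
  then show ?thesis using that psi by blast
qed

text \<open>
  The sets of those \<open>\<rho>\<close> in the closure with \<open>\<rho> (x\<^sup>* x) \<le> d\<close> are closed, and by \<open>mixing_small\<close> finitely
  many of them always have a common point.
\<close>

lemma mixing_closure_meets_radical_annihilator:
  fixes \<omega> :: "'a::unital_cstar_algebra \<Rightarrow> complex"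
  assumes w: "is_state \<omega>"
  obtains \<rho> where "is_state \<rho>" "\<rho> \<in> mixing_closure \<omega>" "\<And>x. x \<in> strong_radical \<Longrightarrow> \<rho> x = 0"
proof -
  let ?S = "closure {\<omega> \<circ> \<psi> |\<psi>. \<psi> \<in> elementary_maps}"
  let ?f = "\<lambda>(x :: 'a, d). {g :: 'a \<Rightarrow> complex. Re (g (adj x * x)) \<le> d}"
  have sub: "?S \<subseteq> {\<omega>. is_state \<omega>}"
    by (rule closure_states_subset) (use w state_elementary in blast)
  have "compact ?S"
    by (rule compact_closure_states) (use w state_elementary in blast)
  then have "?S \<inter> \<Inter>(?f ` (strong_radical \<times> {0<..})) \<noteq> {}"
  proof (rule compact_imp_fip_image)
    fix i :: "'a \<times> real"
    have "continuous_on UNIV (\<lambda>g :: 'a \<Rightarrow> complex. g y)" for y by (rule continuous_on_product_coordinates)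
    then show "closed (?f i)"
      by (auto split: prod.splits intro!: closed_Collect_le continuous_intros)
  next
    fix I' :: "('a \<times> real) set"
    assume I': "finite I'" "I' \<subseteq> strong_radical \<times> {0<..}"
    define d where "d = Min (insert 1 (snd ` I'))"
    have d: "d > 0" using I' by (auto simp: d_def)
    obtain xs where xs: "set xs = fst ` I'" using finite_list[OF finite_imageI[OF I'(1), of fst]] by blast
    have "set xs \<subseteq> strong_radical" unfolding xs using I'(2) by auto
    from mixing_small[OF this d] obtain \<psi> where psi: "\<psi> \<in> elementary_maps"
      "\<And>\<omega> x. is_state \<omega> \<Longrightarrow> x \<in> set xs \<Longrightarrow> Re (\<omega> (\<psi> (adj x * x))) \<le> d" by metis
    have "\<omega> \<circ> \<psi> \<in> ?f i" if i: "i \<in> I'" for i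
    proof -
      have "fst i \<in> set xs" using i xs by simp
      then have "Re (\<omega> (\<psi> (adj (fst i) * fst i))) \<le> d" by (rule psi(2)[OF w])
      moreover have "d \<le> snd i" using i I'(1) by (simp add: d_def)
      ultimately show ?thesis by (auto simp: case_prod_unfold)
    qed
    then have "\<omega> \<circ> \<psi> \<in> \<Inter>(?f ` I')" by (rule INT_I)
    moreover have "\<omega> \<circ> \<psi> \<in> ?S" using psi(1) by (intro subsetD[OF closure_subset]) blast
    ultimately show "?S \<inter> \<Inter>(?f ` I') \<noteq> {}" by blast
  qed
  then obtain \<rho> where rho: "\<rho> \<in> ?S" "\<rho> \<in> \<Inter>(?f ` (strong_radical \<times> {0<..}))" by blast
  have small: "Re (\<rho> (adj x * x)) \<le> d" if "x \<in> strong_radical" "d > 0" for x d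
    using INT_D[OF rho(2), of "(x, d)"] that by simp
  have st: "is_state \<rho>" using rho(1) sub by blast
  have vanish: "\<rho> x = 0" if x: "x \<in> strong_radical" for x
  proof (rule state_zero_of_square_zero[OF st])
    have "Re (\<rho> (adj x * x)) \<le> 0" by (rule field_le_epsilon) (use small[OF x] in simp)
    then show "\<rho> (adj x * x) = 0" using state_pos[OF st pos_adj_mult[of x]] by (simp add: complex_eq_iff)
  qed
  show ?thesis
    by (rule that[OF st _ vanish]) (use rho(1) mixing_closure_eq[OF w] in simp_all)
qed

lemma ideal_elementary:
  assumes I: "is_ideal I" and x: "x \<in> I" and psi: "\<psi> \<in> elementary_maps"
  shows "\<psi> x \<in> I"
proof -
  obtain vs where "\<psi> = (\<lambda>x. \<Sum>v\<leftarrow>vs. adj v * x * v)" using elementary_mapE[OF psi] by blast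
  moreover have "adj v * x * v \<in> I" for v
    by (rule ideal_mult_right[OF I ideal_mult_left[OF I x]])
  ultimately show ?thesis using I by (simp add: ideal_sum_list)
qed

lemma mixing_closure_annihilates:
  assumes w: "is_state \<omega>" and I: "is_ideal I" "\<And>x. x \<in> I \<Longrightarrow> \<omega> x = 0"
    and r: "\<rho> \<in> mixing_closure \<omega>" and x: "x \<in> I"
  shows "\<rho> x = 0"
proof (rule closure_eq_value[where f=\<rho> and x=x])
  show "\<rho> \<in> closure {\<omega> \<circ> \<psi> |\<psi>. \<psi> \<in> elementary_maps}" using r mixing_closure_eq[OF w] by simp
qed (use I(2) ideal_elementary[OF I(1) x] in auto)

theorem maximally_mixed_annihilates_radical:
  fixes \<omega> :: "'a::unital_cstar_algebra \<Rightarrow> complex"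
  assumes "maximally_mixed \<omega>" "x \<in> strong_radical"
  shows "\<omega> x = 0"
proof -
  have w: "is_state \<omega>" using assms(1) by (simp add: maximally_mixed_def)
  obtain \<rho> where r: "is_state \<rho>" "\<rho> \<in> mixing_closure \<omega>" "\<And>x. x \<in> strong_radical \<Longrightarrow> \<rho> x = 0"
    using mixing_closure_meets_radical_annihilator[OF w] by blast
  then have "\<omega> \<in> mixing_closure \<rho>" using assms(1) by (simp add: maximally_mixed_def)
  moreover have "is_ideal (strong_radical :: 'a set)"
    unfolding strong_radical_def by (rule ideal_Inter) (simp add: maximal_ideal_is_ideal)
  ultimately show ?thesis using mixing_closure_annihilates r(1,3) assms(2) by blast
qed

section \<open>Separation of a state from a convex set of states\<close>

text \<open>
  Some finite set \<open>X\<close> of elements witnesses \<open>\<omega> \<notin> closure K\<close>, so the squared Euclidean distance to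
  \<open>\<omega>\<close> on \<open>X\<close> has a positive minimum on the compact set \<open>closure K\<close>, attained at \<open>f0\<close>.  By
  the variational inequality at \<open>f0\<close>, the element \<open>z = \<Sum> cnj (f0 x - \<omega> x) x\<close> separates, and so does its
  self-adjoint part.
\<close>

lemma separation:
  fixes \<omega> :: "'a::unital_cstar_algebra \<Rightarrow> complex"
  assumes K: "\<And>f. f \<in> K \<Longrightarrow> is_state f"
    and conv: "\<And>f g t. f \<in> K \<Longrightarrow> g \<in> K \<Longrightarrow> 0 \<le> t \<Longrightarrow> t \<le> 1 \<Longrightarrow>
      (\<lambda>x. complex_of_real (1 - t) * f x + complex_of_real t * g x) \<in> K"
    and w: "is_state \<omega>" and out: "\<omega> \<notin> closure K"
  obtains a d where "adj a = a" "d > 0" "\<forall>f\<in>K. Re (\<omega> a) + d \<le> Re (f a)"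
proof (cases "K = {}")
  case True
  then show ?thesis using that[of 0 1] by simp
next
  case False
  obtain X e where X: "finite X" "e > 0" "\<not> (\<exists>f\<in>K. \<forall>x\<in>X. cmod (f x - \<omega> x) < e)"
    using out unfolding closure_pointwise by auto
  define F where "F f = (\<Sum>x\<in>X. (cmod (f x - \<omega> x))\<^sup>2)" for f :: "'a \<Rightarrow> complex"
  have sub: "closure K \<subseteq> {\<omega>. is_state \<omega>}" by (rule closure_states_subset) (use K in blast)
  have "compact (closure K)" by (rule compact_closure_states) (use K in blast)
  moreover have "continuous_on (closure K) F"
    unfolding F_def by (intro continuous_intros continuous_on_subset[OF continuous_on_product_coordinates]) auto
  moreover have "closure K \<noteq> {}" using False by simp
  ultimately obtain f0 where f0: "f0 \<in> closure K" "\<And>f. f \<in> closure K \<Longrightarrow> F f0 \<le> F f"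
    using continuous_attains_inf by metis
  have st0: "is_state f0" using f0(1) sub by blast
  define u where "u x = f0 x - \<omega> x" for x
  have "F f0 > 0"
  proof (rule ccontr)
    assume "\<not> F f0 > 0"
    then have "F f0 = 0" using sum_nonneg[of X "\<lambda>x. (cmod (f0 x - \<omega> x))\<^sup>2"] by (simp add: F_def)
    then have z: "f0 x = \<omega> x" if "x \<in> X" for x
      using that X(1) by (simp add: F_def sum_nonneg_eq_0_iff)
    obtain g where "g \<in> K" "\<forall>x\<in>X. cmod (g x - f0 x) < e"
      using f0(1) X(1,2) unfolding closure_pointwise by blast
    then show False using X(3) z by auto
  qed
  define z where "z = (\<Sum>x\<in>X. cnj (u x) *\<^sub>C x)"
  have fz: "f z = (\<Sum>x\<in>X. cnj (u x) * f x)" if "is_state f" for f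
    unfolding z_def using that by (simp add: state_sum state_scaleC)
  have gap0: "Re (f0 z) = Re (\<omega> z) + F f0"
  proof -
    have "f0 z - \<omega> z = (\<Sum>x\<in>X. cnj (u x) * u x)"
      by (simp add: fz st0 w sum_subtractf[symmetric] u_def algebra_simps)
    also have "\<dots> = complex_of_real (F f0)"
      unfolding F_def of_real_sum
      by (intro sum.cong refl) (metis complex_norm_square mult.commute u_def)
    finally show ?thesis by (simp add: complex_eq_iff)
  qed
  have gap: "Re (f0 z) \<le> Re (f z)" if f: "f \<in> K" for f
  proof (rule ccontr)
    assume less: "\<not> Re (f0 z) \<le> Re (f z)"
    define v where "v x = f x - f0 x" for x
    define S where "S = (\<Sum>x\<in>X. Re (cnj (u x) * v x))"
    define V where "V = (\<Sum>x\<in>X. (cmod (v x))\<^sup>2)"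
    have V0: "V \<ge> 0" by (simp add: V_def sum_nonneg)
    have "S = Re (f z - f0 z)"
      by (simp add: fz st0 K f S_def v_def right_diff_distrib sum_subtractf)
    then have S: "S < 0" using less by simp
    have key: "0 \<le> 2 * t * S + t\<^sup>2 * V" if t: "0 \<le> t" "t \<le> 1" for t
    proof -
      define g where "g = (\<lambda>x. complex_of_real (1 - t) * f0 x + complex_of_real t * f x)"
      have "g \<in> closure K"
        unfolding closure_pointwise
      proof (intro allI impI)
        fix Y :: "'a set" and r :: real assume Y: "finite Y" "r > 0"
        then obtain k where k: "k \<in> K" "\<forall>x\<in>Y. cmod (k x - f0 x) < r"
          using f0(1) unfolding closure_pointwise by blast
        have "cmod ((complex_of_real (1 - t) * k x + complex_of_real t * f x) - g x) < r" if "x \<in> Y" for x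
        proof -
          have "(complex_of_real (1 - t) * k x + complex_of_real t * f x) - g x = complex_of_real (1 - t) * (k x - f0 x)"
            by (simp add: g_def algebra_simps)
          then have "cmod ((complex_of_real (1 - t) * k x + complex_of_real t * f x) - g x) = (1 - t) * cmod (k x - f0 x)"
            using t by (simp add: norm_mult del: of_real_diff)
          also have "\<dots> \<le> 1 * cmod (k x - f0 x)" using t by (intro mult_right_mono) auto
          finally show ?thesis using k(2) that by fastforce
        qed
        then show "\<exists>h\<in>K. \<forall>x\<in>Y. cmod (h x - g x) < r" by (intro bexI[OF _ conv[OF k(1) f t]]) blast
      qed
      then have "F f0 \<le> F g" by (rule f0(2))
      also have "F g = (\<Sum>x\<in>X. (cmod (u x))\<^sup>2 + 2 * t * Re (cnj (u x) * v x) + t\<^sup>2 * (cmod (v x))\<^sup>2)"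
        unfolding F_def
      proof (intro sum.cong refl)
        fix x
        have "g x - \<omega> x = u x + complex_of_real t * v x" by (simp add: g_def u_def v_def algebra_simps)
        then show "(cmod (g x - \<omega> x))\<^sup>2 = (cmod (u x))\<^sup>2 + 2 * t * Re (cnj (u x) * v x) + t\<^sup>2 * (cmod (v x))\<^sup>2"
          by (simp add: cmod_power2) (simp add: power2_eq_square algebra_simps)
      qed
      also have "\<dots> = F f0 + 2 * t * S + t\<^sup>2 * V"
        by (simp add: F_def S_def V_def u_def sum.distrib sum_distrib_left)
      finally show ?thesis by simp
    qed
    \<comment> \<open>small enough for the negative linear term to beat the quadratic one\<close>
    define t where "t = min 1 (- S / (V + 1))"
    have t: "0 < t" "t \<le> 1" using divide_neg_pos[OF S, of "V + 1"] V0 by (auto simp: t_def)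
    have V1: "0 < V + 1" using V0 by simp
    have "t \<le> - S / (V + 1)" unfolding t_def by (rule min.cobounded2)
    then have "t * (V + 1) \<le> - S" by (rule iffD1[OF pos_le_divide_eq[OF V1]])
    then have "t * V \<le> - S" using t(1) by (simp add: algebra_simps)
    then have "t * (2 * S + t * V) < 0" using S t(1) by (intro mult_pos_neg) auto
    moreover have "t * (2 * S + t * V) = 2 * t * S + t\<^sup>2 * V" by (simp add: power2_eq_square algebra_simps)
    ultimately show False using key[of t] t by simp
  qed
  define a where "a = (1/2) *\<^sub>R (z + adj z)"
  have fa: "Re (f a) = Re (f z)" if "is_state f" for f
    using that by (simp add: a_def state_linear state_adj)
  show ?thesis
  proof (rule that[of a "F f0"])
    show "adj a = a" by (simp add: a_def adj_simps add.commute)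
    show "\<forall>f\<in>K. Re (\<omega> a) + F f0 \<le> Re (f a)"
      using gap gap0 fa[OF w] fa[OF K] by auto
  qed fact
qed

section \<open>States annihilating a finite intersection of maximal ideals\<close>

lemma elementary_diff:
  assumes "\<psi> \<in> elementary_maps" shows "\<psi> (x - y) = \<psi> x - \<psi> y"
proof -
  obtain vs where "\<psi> = (\<lambda>x. \<Sum>v\<leftarrow>vs. adj v * x * v)" using elementary_mapE[OF assms] by blast
  then show ?thesis by (simp add: sum_list_subtractf algebra_simps)
qed

lemma elementary_one:
  assumes "\<psi> \<in> elementary_maps" shows "\<psi> 1 = 1"
proof -
  obtain vs where "sum_sq vs = 1" "\<psi> = (\<lambda>x. \<Sum>v\<leftarrow>vs. adj v * x * v)" using elementary_mapE[OF assms] by blast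
  then show ?thesis by simp
qed

lemma ideal_sum: "is_ideal I \<Longrightarrow> (\<And>x. x \<in> X \<Longrightarrow> f x \<in> I) \<Longrightarrow> (\<Sum>x\<in>X. f x) \<in> I"
  by (induction X rule: infinite_finite_induct) (auto simp: ideal_zero ideal_add)

lemma sum_list_group:
  fixes f :: "'b \<Rightarrow> 'v \<Rightarrow> 'c::comm_monoid_add"
  assumes "finite L" "\<And>v. v \<in> set vs \<Longrightarrow> lab v \<in> L"
  shows "(\<Sum>M\<in>L. \<Sum>v\<leftarrow>vs. if lab v = M then f M v else 0) = (\<Sum>v\<leftarrow>vs. f (lab v) v)"
  using assms(2) by (induction vs) (auto simp: sum.distrib sum.delta assms(1))

text \<open>
  Modulo \<open>I = \<Inter>\<M>\<close> the elements \<open>e M\<close> below are the central projections of the simple summands: \<open>e M\<close>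
  lies in all members of \<open>\<M>\<close> other than \<open>M\<close>, and \<open>1 - e M\<close> lies in \<open>M\<close>.  They arise by grouping the
  squares of a single partition of unity, which also defines \<open>\<psi>\<close>.  Its generators for \<open>M\<close> are right
  multiples of \<open>(a - s M)\<^sub>+\<close>, so that \<open>v\<^sup>* a v \<ge> s M v\<^sup>* v\<close>; primeness of maximal ideals
  ensures that, together with \<open>I\<close>, they lie in no common maximal ideal.
\<close>

lemma mixing_dominates:
  fixes \<M> :: "'a::unital_cstar_algebra set set"
  assumes fin: "finite \<M>" and max: "\<And>M. M \<in> \<M> \<Longrightarrow> is_maximal_ideal M" and ne: "\<M> \<noteq> {}"
    and a: "adj a = a" and d: "d > 0"
  obtains \<psi> where "\<psi> \<in> elementary_maps"
    "\<forall>\<omega> \<rho>. is_state \<omega> \<and> is_state \<rho> \<and> (\<forall>x\<in>\<Inter>\<M>. \<omega> x = 0) \<and>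
      \<rho> \<in> mixing_closure \<omega> \<longrightarrow> Re (\<omega> a) \<le> Re (\<rho> (\<psi> a)) + d"
proof -
  have ideal: "is_ideal M" if "M \<in> \<M>" for M using max[OF that] by (rule maximal_ideal_is_ideal)
  have "\<forall>M\<in>\<M>. \<exists>s. pos_part (a - s *\<^sub>R 1) \<notin> M \<and> pos_part (a - (s + d) *\<^sub>R 1) \<in> M"
  proof
    fix M assume "M \<in> \<M>"
    from spectral_threshold[OF ideal[OF this] maximal_ideal_one[OF max[OF this]] a d]
    obtain r where "pos_part (a - r *\<^sub>R 1) \<notin> M" "pos_part (a - (r + d) *\<^sub>R 1) \<in> M" .
    then show "\<exists>s. pos_part (a - s *\<^sub>R 1) \<notin> M \<and> pos_part (a - (s + d) *\<^sub>R 1) \<in> M" by blast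
  qed
  then obtain s where s: "\<And>M. M \<in> \<M> \<Longrightarrow> pos_part (a - s M *\<^sub>R 1) \<notin> M"
      "\<And>M. M \<in> \<M> \<Longrightarrow> pos_part (a - (s M + d) *\<^sub>R 1) \<in> M" by metis
  define c where "c M = pos_part (a - s M *\<^sub>R 1)" for M
  define I where "I = \<Inter>\<M>"
  define L where "L M = \<Inter>(\<M> - {M})" for M
  have idI: "is_ideal I" unfolding I_def by (rule ideal_Inter) (rule ideal)
  have idL: "is_ideal (L M)" for M unfolding L_def by (rule ideal_Inter) (use ideal in blast)
  have IL: "I \<subseteq> L M" for M unfolding I_def L_def by blast
  have LN: "x \<in> N" if "x \<in> L M" "N \<in> \<M>" "N \<noteq> M" for x M N using that unfolding L_def by blast
  have inI: "x \<in> I" if "x \<in> L M" "x \<in> M" for x M using that unfolding I_def L_def by blast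
  \<comment> \<open>\<open>I\<close> is included to confine the maximal ideals containing \<open>G\<close> to \<open>\<M>\<close>\<close>
  define G where "G = I \<union> (\<Union>M\<in>\<M>. {g \<in> L M. \<exists>y. g = c M * y})"
  have "\<not> G \<subseteq> N" if N: "is_maximal_ideal N" for N
  proof
    assume GN: "G \<subseteq> N"
    then have NM: "N \<in> \<M>" using Inter_maximal_subset[OF fin max N] by (auto simp: G_def I_def)
    have "\<not> L N \<subseteq> N" using Inter_maximal_subset[of "\<M> - {N}" N] fin max N unfolding L_def by blast
    then obtain z where z: "z \<in> L N" "z \<notin> N" by blast
    have "c N \<notin> N" using s(1)[OF NM] by (simp add: c_def)
    then obtain y where y: "c N * y * z \<notin> N" using maximal_ideal_prime[OF N _ z(2)] by blast
    have "c N * y * z \<in> L N" using idL z(1) by (rule ideal_mult_left)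
    then have "c N * y * z \<in> G" using NM unfolding G_def by (auto simp: mult.assoc)
    then show False using GN y by blast
  qed
  then obtain vs where vs: "\<And>v. v \<in> set vs \<Longrightarrow> \<exists>g\<in>G. \<exists>y. v = g * y" "sum_sq vs = 1"
    using partition_of_unity by blast
  have "\<exists>M. M \<in> \<M> \<and> v \<in> L M \<and> (v \<in> I \<or> (\<exists>y. v = c M * y))" if v: "v \<in> set vs" for v
  proof -
    obtain g y where gy: "g \<in> G" "v = g * y" using vs(1)[OF v] by blast
    show ?thesis
    proof (cases "g \<in> I")
      case True
      then have "v \<in> I" unfolding gy(2) by (rule ideal_mult_right[OF idI])
      then show ?thesis using ne IL by blast
    next
      case False
      then obtain M y' where M: "M \<in> \<M>" "g \<in> L M" "g = c M * y'" using gy(1) unfolding G_def by blast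
      have "v \<in> L M" unfolding gy(2) using idL M(2) by (rule ideal_mult_right)
      moreover have "v = c M * (y' * y)" unfolding gy(2) M(3) by (simp add: mult.assoc)
      ultimately show ?thesis using M(1) by blast
    qed
  qed
  then obtain lab where lab: "\<And>v. v \<in> set vs \<Longrightarrow> lab v \<in> \<M>" "\<And>v. v \<in> set vs \<Longrightarrow> v \<in> L (lab v)"
      "\<And>v. v \<in> set vs \<Longrightarrow> v \<in> I \<or> (\<exists>y. v = c (lab v) * y)" by metis
  define e where "e M = (\<Sum>v\<leftarrow>vs. if lab v = M then adj v * v else 0)" for M
  have e_sum: "(\<Sum>M\<in>\<M>. e M) = 1"
    unfolding e_def using sum_list_group[OF fin, of vs lab "\<lambda>_ v. adj v * v"] lab(1) vs(2) by simp
  have e_L: "e M \<in> L M" for M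
    unfolding e_def using lab(2) by (intro ideal_sum_list idL) (auto intro: ideal_mult_left idL ideal_zero)
  have e_M: "1 - e M \<in> M" if M: "M \<in> \<M>" for M
  proof -
    have "1 - e M = (\<Sum>N\<in>\<M> - {M}. e N)" using e_sum sum.remove[OF fin M, of e] by (metis add_diff_cancel_left')
    also have "\<dots> \<in> M" by (rule ideal_sum[OF ideal[OF M]]) (use LN[OF e_L M] in auto)
    finally show ?thesis .
  qed
  have e_sa: "adj (e M) = e M" for M
    unfolding e_def by (induction vs) (auto simp: adj_simps)
  \<comment> \<open>\<open>e M\<close> acts as a central projection as far as states annihilating \<open>I\<close> can see\<close>
  have sandwich: "\<tau> (e M * x * e M) = \<tau> (e M * x)"
    if t: "is_state \<tau>" "\<And>x. x \<in> I \<Longrightarrow> \<tau> x = 0" and M: "M \<in> \<M>" for \<tau> M x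
  proof -
    have "e M * x * (1 - e M) \<in> I"
      by (rule inI[OF ideal_mult_right[OF idL ideal_mult_right[OF idL e_L]] ideal_mult_left[OF ideal[OF M] e_M[OF M]]])
    then have "\<tau> (e M * x * (1 - e M)) = 0" by (rule t(2))
    then show ?thesis using t(1) by (simp add: algebra_simps state_diff)
  qed
  define \<psi> where "\<psi> = (\<lambda>x. \<Sum>v\<leftarrow>vs. adj v * x * v)"
  have psi: "\<psi> \<in> elementary_maps" unfolding \<psi>_def by (rule elementary_mapI[OF vs(2)])
  have "Re (\<omega> a) \<le> Re (\<rho> (\<psi> a)) + d"
    if w: "is_state \<omega>" and r: "is_state \<rho>" and w0: "\<forall>x\<in>\<Inter>\<M>. \<omega> x = 0"
      and mix: "\<rho> \<in> mixing_closure \<omega>" for \<omega> \<rho>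
  proof -
    have wI: "\<omega> x = 0" if "x \<in> I" for x using w0 that by (auto simp: I_def)
    have rI: "\<rho> x = 0" if "x \<in> I" for x by (rule mixing_closure_annihilates[OF w idI wI mix that])
    \<comment> \<open>mixing preserves the weights of the summands\<close>
    have same: "\<rho> (e M) = \<omega> (e M)" if M: "M \<in> \<M>" for M
    proof (rule closure_eq_value[where f=\<rho> and x="e M"])
      show "\<rho> \<in> closure {\<omega> \<circ> \<psi> |\<psi>. \<psi> \<in> elementary_maps}" using mix mixing_closure_eq[OF w] by simp
      fix g assume "g \<in> {\<omega> \<circ> \<psi> |\<psi>. \<psi> \<in> elementary_maps}"
      then obtain \<phi> where phi: "\<phi> \<in> elementary_maps" "g = \<omega> \<circ> \<phi>" by blast
      have "\<phi> (e M) - e M \<in> L M" by (rule ideal_diff[OF idL ideal_elementary[OF idL e_L phi(1)] e_L])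
      moreover have "(1 - e M) - \<phi> (1 - e M) \<in> M"
        by (rule ideal_diff[OF ideal[OF M] e_M[OF M] ideal_elementary[OF ideal[OF M] e_M[OF M] phi(1)]])
      then have "\<phi> (e M) - e M \<in> M" by (simp add: elementary_diff[OF phi(1)] elementary_one[OF phi(1)])
      ultimately have "\<omega> (\<phi> (e M) - e M) = 0" using inI wI by blast
      then show "g (e M) = \<omega> (e M)" by (simp add: phi(2) state_diff[OF w])
    qed
    have upper: "Re (\<omega> (e M * a)) \<le> (s M + d) * Re (\<omega> (e M))" if M: "M \<in> \<M>" for M
    proof -
      let ?h = "a - (s M + d) *\<^sub>R 1"
      let ?u = "pos_part ?h"
      have "pos (?u - ?h)" by (rule pos_part) (simp add: adj_simps a)
      then have "pos (adj (e M) * (?u - ?h) * e M)" by (rule pos_conj)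
      then have "0 \<le> Re (\<omega> (e M * (?u - ?h) * e M))" using state_pos[OF w] by (simp add: e_sa)
      moreover have "e M * (?u - ?h) * e M = e M * ?u * e M - e M * a * e M + (s M + d) *\<^sub>R (e M * 1 * e M)"
        by (simp add: algebra_simps)
      moreover have "e M * ?u * e M \<in> I"
        by (rule inI[OF ideal_mult_right[OF idL ideal_mult_right[OF idL e_L]]
              ideal_mult_right[OF ideal[OF M] ideal_mult_left[OF ideal[OF M] s(2)[OF M]]]])
      then have "\<omega> (e M * ?u * e M) = 0" by (rule wI)
      ultimately have "0 \<le> - Re (\<omega> (e M * a * e M)) + (s M + d) * Re (\<omega> (e M * 1 * e M))"
        using w by (simp add: state_linear del: mult_1_right)
      then show ?thesis using sandwich[OF w wI M, of a] sandwich[OF w wI M, of 1] by simp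
    qed
    have "Re (\<omega> a) = Re (\<omega> ((\<Sum>M\<in>\<M>. e M) * a))" unfolding e_sum by simp
    also have "\<dots> = (\<Sum>M\<in>\<M>. Re (\<omega> (e M * a)))" unfolding sum_distrib_right state_sum[OF w] by (rule Re_sum)
    also have "\<dots> \<le> (\<Sum>M\<in>\<M>. (s M + d) * Re (\<omega> (e M)))" by (rule sum_mono) (rule upper)
    also have "\<dots> = (\<Sum>M\<in>\<M>. s M * Re (\<omega> (e M))) + d * Re (\<omega> (\<Sum>M\<in>\<M>. e M))"
      unfolding state_sum[OF w] Re_sum sum_distrib_left by (simp add: sum.distrib distrib_right)
    also have "\<dots> = (\<Sum>M\<in>\<M>. s M * Re (\<rho> (e M))) + d"
      unfolding e_sum state_one[OF w] using same by simp
    also have "(\<Sum>M\<in>\<M>. s M * Re (\<rho> (e M))) = (\<Sum>v\<leftarrow>vs. s (lab v) * Re (\<rho> (adj v * v)))"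
    proof -
      have "s M * Re (\<rho> (e M)) = (\<Sum>v\<leftarrow>vs. if lab v = M then s M * Re (\<rho> (adj v * v)) else 0)" for M
        unfolding e_def by (induction vs) (auto simp: state_linear[OF r] algebra_simps)
      then show ?thesis using sum_list_group[OF fin, of vs lab "\<lambda>M v. s M * Re (\<rho> (adj v * v))"] lab(1) by simp
    qed
    also have "\<dots> \<le> (\<Sum>v\<leftarrow>vs. Re (\<rho> (adj v * a * v)))"
    proof (rule sum_list_mono)
      fix v assume v: "v \<in> set vs"
      show "s (lab v) * Re (\<rho> (adj v * v)) \<le> Re (\<rho> (adj v * a * v))"
      proof (cases "v \<in> I")
        case True
        then have "adj v * v \<in> I" "adj v * a * v \<in> I" using idI by (auto intro: ideal_mult_left)
        then show ?thesis by (simp add: rI)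
      next
        case False
        then obtain y where y: "v = c (lab v) * y" using lab(3)[OF v] by blast
        let ?h = "a - s (lab v) *\<^sub>R 1"
        have h: "adj ?h = ?h" using a by (simp add: adj_simps)
        have "adj v * ?h * v = adj y * (c (lab v) * ?h * c (lab v)) * y"
          using pos_selfadjoint[OF pos_part(1)[OF h]] by (subst (1 2) y) (simp add: adj_simps c_def mult.assoc)
        then have "pos (adj v * ?h * v)" using pos_part(4)[OF h] pos_conj by (simp add: c_def)
        then have "0 \<le> Re (\<rho> (adj v * ?h * v))" using state_pos[OF r] by blast
        moreover have "adj v * ?h * v = adj v * a * v - s (lab v) *\<^sub>R (adj v * v)" by (simp add: algebra_simps)
        ultimately show ?thesis by (simp add: state_linear[OF r])
      qed
    qed
    also have "\<dots> = Re (\<rho> (\<psi> a))"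
      unfolding \<psi>_def by (induction vs) (simp_all add: state_linear[OF r])
    finally show ?thesis by simp
  qed
  then show ?thesis using that psi by blast
qed

lemma elementary_convex:
  assumes "\<phi> \<in> elementary_maps" "\<psi> \<in> elementary_maps" "0 \<le> t" "t \<le> (1::real)"
  shows "(\<lambda>x. (1 - t) *\<^sub>R \<phi> x + t *\<^sub>R \<psi> x) \<in> elementary_maps"
proof -
  obtain vs where vs: "sum_sq vs = 1" "\<phi> = (\<lambda>x. \<Sum>v\<leftarrow>vs. adj v * x * v)"
    using elementary_mapE[OF assms(1)] by blast
  obtain ws where ws: "sum_sq ws = 1" "\<psi> = (\<lambda>x. \<Sum>v\<leftarrow>ws. adj v * x * v)"
    using elementary_mapE[OF assms(2)] by blast
  let ?us = "map (\<lambda>v. v * (sqrt (1 - t) *\<^sub>R 1)) vs @ map (\<lambda>v. v * (sqrt t *\<^sub>R 1)) ws"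
  have eq: "(\<Sum>v\<leftarrow>?us. adj v * x * v) = (1 - t) *\<^sub>R \<phi> x + t *\<^sub>R \<psi> x" for x
    unfolding map_append sum_list_append sum_list_conj_right using assms(3,4)
    by (simp add: vs(2) ws(2) adj_scaleR)
  have "sum_sq ?us = 1"
    using eq[of 1] elementary_one[OF assms(1)] elementary_one[OF assms(2)]
    by (simp flip: scaleR_add_left)
  from elementary_mapI[OF this] show ?thesis unfolding eq .
qed

theorem maximally_mixed_of_finite_intersection:
  fixes \<omega> :: "'a::unital_cstar_algebra \<Rightarrow> complex"
  assumes w: "is_state \<omega>" and fin: "finite \<M>" and ne: "\<M> \<noteq> {}"
    and max: "\<And>M. M \<in> \<M> \<Longrightarrow> is_maximal_ideal M" and w0: "\<And>x. x \<in> \<Inter>\<M> \<Longrightarrow> \<omega> x = 0"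
  shows "maximally_mixed \<omega>"
  unfolding maximally_mixed_def
proof (intro conjI allI impI w)
  fix \<rho> :: "'a \<Rightarrow> complex"
  assume r: "is_state \<rho>" and mix: "\<rho> \<in> mixing_closure \<omega>"
  let ?K = "{\<rho> \<circ> \<psi> |\<psi>. \<psi> \<in> elementary_maps}"
  show "\<omega> \<in> mixing_closure \<rho>"
  proof (rule ccontr)
    assume "\<omega> \<notin> mixing_closure \<rho>"
    then have out: "\<omega> \<notin> closure ?K" using mixing_closure_eq[OF r] by simp
    have K: "is_state f" if "f \<in> ?K" for f using that state_elementary[OF r] by blast
    have conv: "(\<lambda>x. complex_of_real (1 - t) * f x + complex_of_real t * g x) \<in> ?K"
      if fg: "f \<in> ?K" "g \<in> ?K" and t: "0 \<le> t" "t \<le> 1" for f g t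
    proof -
      obtain \<phi> where phi: "\<phi> \<in> elementary_maps" "f = \<rho> \<circ> \<phi>" using fg(1) by blast
      obtain \<psi> where psi: "\<psi> \<in> elementary_maps" "g = \<rho> \<circ> \<psi>" using fg(2) by blast
      have "(\<lambda>x. complex_of_real (1 - t) * f x + complex_of_real t * g x) = \<rho> \<circ> (\<lambda>x. (1 - t) *\<^sub>R \<phi> x + t *\<^sub>R \<psi> x)"
        by (simp add: fun_eq_iff phi(2) psi(2) state_add[OF r] state_scaleR[OF r])
      then show ?thesis using elementary_convex[OF phi(1) psi(1) t] by blast
    qed
    from separation[of ?K, OF K conv w out]
    obtain a d where ad: "adj a = a" "d > 0" "\<forall>f\<in>?K. Re (\<omega> a) + d \<le> Re (f a)" .
    have sa: "adj (- a) = - a" using ad(1) by (simp add: adj_minus)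
    have d2: "d / 2 > 0" using ad(2) by simp
    from mixing_dominates[OF fin max ne sa d2]
    obtain \<psi> where psi: "\<psi> \<in> elementary_maps"
      "\<forall>\<omega> \<rho>. is_state \<omega> \<and> is_state \<rho> \<and> (\<forall>x\<in>\<Inter>\<M>. \<omega> x = 0) \<and>
        \<rho> \<in> mixing_closure \<omega> \<longrightarrow> Re (\<omega> (- a)) \<le> Re (\<rho> (\<psi> (- a))) + d / 2" .
    have "Re (\<omega> (- a)) \<le> Re ((\<rho> \<circ> \<psi>) (- a)) + d / 2" using psi(2) w r w0 mix by (metis comp_apply)
    moreover have "Re (\<omega> a) + d \<le> Re ((\<rho> \<circ> \<psi>) a)" by (rule bspec[OF ad(3)]) (use psi(1) in blast)
    ultimately show False
      using ad(2) state_minus[OF w] state_minus[OF state_elementary[OF r psi(1)]] by simp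
  qed
qed

section \<open>States annihilating a maximal ideal\<close>

definition convex_cone :: "'a::real_vector set \<Rightarrow> bool" where
  "convex_cone C \<longleftrightarrow> 0 \<in> C \<and> (\<forall>x\<in>C. \<forall>y\<in>C. x + y \<in> C) \<and> (\<forall>r\<ge>0. \<forall>x\<in>C. r *\<^sub>R x \<in> C)"

lemma convex_coneD:
  assumes "convex_cone C"
  shows "0 \<in> C" "x \<in> C \<Longrightarrow> y \<in> C \<Longrightarrow> x + y \<in> C" "r \<ge> 0 \<Longrightarrow> x \<in> C \<Longrightarrow> r *\<^sub>R x \<in> C"
  using assms by (auto simp: convex_cone_def)

text \<open>
  A cone that is maximal among those avoiding \<open>- e\<close> decides every vector: if adjoining \<open>x\<close> produces
  \<open>- e = c + t x\<close>, then \<open>- x\<close> is a positive multiple of \<open>c + e\<close>.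
\<close>

lemma maximal_cone:
  fixes C0 :: "'a::real_vector set"
  assumes C0: "convex_cone C0" and e: "- e \<notin> C0" "e \<in> C0"
  obtains C where "convex_cone C" "C0 \<subseteq> C" "- e \<notin> C" "\<forall>x. x \<in> C \<or> - x \<in> C"
proof -
  define P where "P = {C. convex_cone C \<and> C0 \<subseteq> C \<and> - e \<notin> C}"
  have "\<exists>U\<in>P. \<forall>X\<in>K. X \<subseteq> U" if K: "subset.chain P K" for K
  proof (cases "K = {}")
    case True
    then show ?thesis using C0 e by (auto simp: P_def)
  next
    case False
    have KP: "convex_cone X" "C0 \<subseteq> X" "- e \<notin> X" if "X \<in> K" for X
      using K that unfolding subset.chain_def P_def by auto
    have "x + y \<in> \<Union>K" if xy: "x \<in> \<Union>K" "y \<in> \<Union>K" for x y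
    proof -
      obtain X where X: "X \<in> K" "x \<in> X" using xy(1) by blast
      obtain Y where Y: "Y \<in> K" "y \<in> Y" using xy(2) by blast
      have "X \<subseteq> Y \<or> Y \<subseteq> X" using K X(1) Y(1) unfolding subset.chain_def by auto
      then show ?thesis
        using X Y convex_coneD(2)[OF KP(1)[OF X(1)]] convex_coneD(2)[OF KP(1)[OF Y(1)]] by blast
    qed
    moreover have "r *\<^sub>R x \<in> \<Union>K" if "r \<ge> 0" "x \<in> \<Union>K" for r x
      using that convex_coneD(3)[OF KP(1)] by blast
    moreover have "0 \<in> \<Union>K" using False convex_coneD(1)[OF KP(1)] by blast
    ultimately have "convex_cone (\<Union>K)" unfolding convex_cone_def by blast
    moreover have "C0 \<subseteq> \<Union>K" using False KP(2) by blast
    moreover have "- e \<notin> \<Union>K" using KP(3) by blast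
    ultimately have "\<Union>K \<in> P" by (simp add: P_def)
    then show ?thesis by blast
  qed
  then obtain C where C: "C \<in> P" "\<forall>X\<in>P. C \<subseteq> X \<longrightarrow> X = C"
    using subset_Zorn[of P] by blast
  have cone: "convex_cone C" "C0 \<subseteq> C" "- e \<notin> C" using C(1) by (auto simp: P_def)
  note cC = convex_coneD[OF cone(1)]
  have "x \<in> C \<or> - x \<in> C" for x
  proof (rule ccontr)
    assume not: "\<not> (x \<in> C \<or> - x \<in> C)"
    define D where "D = {c + t *\<^sub>R x |c t. c \<in> C \<and> t \<ge> 0}"
    have "convex_cone D"
      unfolding convex_cone_def
    proof (intro conjI ballI allI impI)
      have "0 = 0 + 0 *\<^sub>R x" "(0::real) \<ge> 0" by auto
      then show "0 \<in> D" unfolding D_def using cC(1) by blast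
      show "u + v \<in> D" if uv: "u \<in> D" "v \<in> D" for u v
      proof -
        obtain c t where c: "u = c + t *\<^sub>R x" "c \<in> C" "t \<ge> 0" using uv(1) unfolding D_def by blast
        obtain c' t' where c': "v = c' + t' *\<^sub>R x" "c' \<in> C" "t' \<ge> 0" using uv(2) unfolding D_def by blast
        have "u + v = (c + c') + (t + t') *\<^sub>R x" by (simp add: c c' algebra_simps)
        moreover have "c + c' \<in> C" "t + t' \<ge> 0" using cC(2) c c' by auto
        ultimately show ?thesis unfolding D_def by blast
      qed
      show "r *\<^sub>R u \<in> D" if r: "r \<ge> 0" and u: "u \<in> D" for r u
      proof -
        obtain c t where c: "u = c + t *\<^sub>R x" "c \<in> C" "t \<ge> 0" using u unfolding D_def by blast
        have "r *\<^sub>R u = r *\<^sub>R c + (r * t) *\<^sub>R x" by (simp add: c algebra_simps)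
        moreover have "r *\<^sub>R c \<in> C" "r * t \<ge> 0" using cC(3) c r by auto
        ultimately show ?thesis unfolding D_def by blast
      qed
    qed
    moreover have CD: "C \<subseteq> D"
    proof
      fix c assume "c \<in> C"
      then have "c = c + 0 *\<^sub>R x" "c \<in> C" "(0::real) \<ge> 0" by auto
      then show "c \<in> D" unfolding D_def by blast
    qed
    moreover have "x \<in> D"
    proof -
      have "x = 0 + 1 *\<^sub>R x" "(1::real) \<ge> 0" by auto
      then show ?thesis unfolding D_def using cC(1) by blast
    qed
    ultimately have "- e \<in> D" using bspec[OF C(2), of D] not cone(2) unfolding P_def by blast
    then obtain c t where ct: "- e = c + t *\<^sub>R x" "c \<in> C" "t \<ge> 0" unfolding D_def by blast
    then have "t \<noteq> 0" using cone(3) by auto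
    then have t: "t > 0" using ct(3) by simp
    have "t *\<^sub>R (- x) = c + e"
    proof -
      have "t *\<^sub>R x = - e - c" using ct(1) by (metis add_diff_cancel_left')
      then show ?thesis by simp
    qed
    moreover have "c + e \<in> C" using cC(2) ct(2) e(2) cone(2) by blast
    ultimately have "(1/t) *\<^sub>R (t *\<^sub>R (- x)) \<in> C" using cC(3)[of "1/t"] t by simp
    then show False using not t by simp
  qed
  then show ?thesis using that cone by blast
qed

text \<open>
  This is the positive extension theorem of M. Riesz and Krein with an order unit \<open>e\<close>.  For a cone that
  decides every vector, \<open>x\<close> determines a cut of the real line into those \<open>r\<close> with \<open>x - r e\<close> in the cone and
  those with \<open>r e - x\<close> in it; the functional takes \<open>x\<close> to this cut.
\<close>

lemma cone_functional:
  fixes C0 :: "'a::real_vector set"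
  assumes C0: "convex_cone C0" and e: "- e \<notin> C0" "e \<in> C0"
    and unit: "\<And>x. \<exists>t. t *\<^sub>R e - x \<in> C0"
  obtains f :: "'a \<Rightarrow> real" where "linear f" "f e = 1" "\<forall>x\<in>C0. 0 \<le> f x"
proof -
  obtain C where C: "convex_cone C" "C0 \<subseteq> C" "- e \<notin> C" "\<forall>x. x \<in> C \<or> - x \<in> C"
    by (rule maximal_cone[OF C0 e])
  note cC = convex_coneD[OF C(1)]
  have eC: "r *\<^sub>R e \<in> C" if "r \<ge> 0" for r using that cC(3) e(2) C(2) by blast
  have nonneg: "0 \<le> r" if "r *\<^sub>R e \<in> C" for r
  proof (rule ccontr)
    assume "\<not> 0 \<le> r"
    then have r: "r < 0" by simp
    then have "(- 1 / r) *\<^sub>R (r *\<^sub>R e) \<in> C" by (intro cC(3)[OF _ that]) (simp add: divide_nonpos_neg)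
    moreover have "(- 1 / r) *\<^sub>R (r *\<^sub>R e) = - e" using r by simp
    ultimately show False using C(3) by simp
  qed
  have compare: "r \<le> t" if "x - r *\<^sub>R e \<in> C" "t *\<^sub>R e - x \<in> C" for r t x
    using nonneg[of "t - r"] cC(2)[OF that] by (simp add: algebra_simps)
  define T where "T x = {t. t *\<^sub>R e - x \<in> C}" for x
  define f where "f x = Inf (T x)" for x
  have T_ne: "T x \<noteq> {}" for x using unit[of x] C(2) by (auto simp: T_def)
  have T_bdd: "bdd_below (T x)" for x
  proof -
    obtain t where "t *\<^sub>R e - (- x) \<in> C" using unit[of "- x"] C(2) by blast
    then have "x - (- t) *\<^sub>R e \<in> C" by (simp add: add.commute)
    then show ?thesis using compare by (intro bdd_belowI[of _ "- t"]) (auto simp: T_def)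
  qed
  have below: "r \<le> f x" if "x - r *\<^sub>R e \<in> C" for r x
    unfolding f_def by (rule cInf_greatest[OF T_ne]) (use compare[OF that] in \<open>auto simp: T_def\<close>)
  have above: "f x \<le> t" if "t *\<^sub>R e - x \<in> C" for t x
    unfolding f_def by (rule cInf_lower[OF _ T_bdd]) (use that in \<open>simp add: T_def\<close>)
  have below': "x - r *\<^sub>R e \<in> C" if "r < f x" for r x
  proof -
    have "r *\<^sub>R e - x \<notin> C" using above[of r x] that by auto
    then show ?thesis using C(4)[rule_format, of "r *\<^sub>R e - x"] by simp
  qed
  have eqI: "f x = y" if "\<And>r. r < y \<Longrightarrow> x - r *\<^sub>R e \<in> C" "\<And>t. y < t \<Longrightarrow> t *\<^sub>R e - x \<in> C" for x y
  proof (rule antisym)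
    show "f x \<le> y" by (rule dense_ge) (use above that(2) in blast)
    show "y \<le> f x" by (rule dense_le) (use below that(1) in blast)
  qed
  have above': "t *\<^sub>R e - x \<in> C" if "f x < t" for t x
  proof -
    obtain s where s: "s *\<^sub>R e - x \<in> C" "s < t"
      using cInf_lessD[OF T_ne, of x t] \<open>f x < t\<close> by (auto simp: f_def T_def)
    have "(s *\<^sub>R e - x) + (t - s) *\<^sub>R e \<in> C" using s eC by (intro cC(2)) auto
    then show ?thesis by (simp add: algebra_simps)
  qed
  have f_add: "f (x + y) = f x + f y" for x y
  proof (rule eqI)
    fix r assume "r < f x + f y"
    then obtain a b where ab: "a < f x" "b < f y" "r = a + b"
      by (intro that[of "f x - (f x + f y - r) / 2" "f y - (f x + f y - r) / 2"]) auto
    from cC(2)[OF below'[OF ab(1)] below'[OF ab(2)]]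
    show "x + y - r *\<^sub>R e \<in> C" by (simp add: ab(3) algebra_simps)
  next
    fix r assume "f x + f y < r"
    then obtain a b where ab: "f x < a" "f y < b" "r = a + b"
      by (intro that[of "f x + (r - f x - f y) / 2" "f y + (r - f x - f y) / 2"]) (auto simp: field_simps)
    from cC(2)[OF above'[OF ab(1)] above'[OF ab(2)]]
    show "r *\<^sub>R e - (x + y) \<in> C" by (simp add: ab(3) algebra_simps)
  qed
  have f0: "f 0 = 0" using f_add[of 0 0] by simp
  have f_pos: "f (r *\<^sub>R x) = r * f x" if r: "r > 0" for r x
  proof (rule eqI)
    fix s assume "s < r * f x"
    then have "s / r < f x" using r by (simp add: divide_less_eq mult.commute)
    from cC(3)[OF less_imp_le[OF r] below'[OF this]]
    show "r *\<^sub>R x - s *\<^sub>R e \<in> C" using r by (simp add: scaleR_right_diff_distrib)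
  next
    fix s assume "r * f x < s"
    then have "f x < s / r" using r by (simp add: less_divide_eq mult.commute)
    from cC(3)[OF less_imp_le[OF r] above'[OF this]]
    show "s *\<^sub>R e - r *\<^sub>R x \<in> C" using r by (simp add: scaleR_right_diff_distrib)
  qed
  have f_minus: "f (- x) = - f x" for x using f_add[of x "- x"] f0 by simp
  have f_scale: "f (r *\<^sub>R x) = r * f x" for r x
  proof -
    consider "r > 0" | "r = 0" | "- r > 0" by linarith
    then show ?thesis
    proof cases
      case 3
      then have "f ((- r) *\<^sub>R x) = (- r) * f x" by (rule f_pos)
      then show ?thesis using f_minus[of "r *\<^sub>R x"] by simp
    qed (auto simp: f_pos f0)
  qed
  have "linear f" by (rule linearI) (simp_all add: f_add f_scale)
  moreover have "f e = 1"
  proof (rule eqI)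
    show "e - r *\<^sub>R e \<in> C" if "r < 1" for r using eC[of "1 - r"] that by (simp add: algebra_simps)
    show "t *\<^sub>R e - e \<in> C" if "1 < t" for t using eC[of "t - 1"] that by (simp add: algebra_simps)
  qed
  moreover have "\<forall>x\<in>C0. 0 \<le> f x" using below[where r=0] C(2) by auto
  ultimately show ?thesis using that by blast
qed

text \<open>
  A complex-linear functional is determined by its real part \<open>f\<close>.  Vanishing of \<open>f\<close> on skew-adjoint
  elements makes the functional real on self-adjoint ones.
\<close>

lemma state_of_real_functional:
  fixes f :: "'a::unital_cstar_algebra \<Rightarrow> real"
  assumes lin: "linear f" and one: "f 1 = 1" and nonneg: "\<And>x. pos x \<Longrightarrow> 0 \<le> f x"
    and skew: "\<And>x. adj x = - x \<Longrightarrow> f x = 0"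
  shows "is_state (\<lambda>x. Complex (f x) (- f (\<i> *\<^sub>C x)))"
proof -
  have skew_i: "f (\<i> *\<^sub>C h) = 0" if "adj h = h" for h
    by (rule skew) (simp add: adj_scaleC that scaleC_minus_left)
  have scale: "f (c *\<^sub>C x) = Re c * f x + Im c * f (\<i> *\<^sub>C x)" for c x
  proof -
    have "c *\<^sub>C x = Re c *\<^sub>R x + Im c *\<^sub>R (\<i> *\<^sub>C x)"
      unfolding scaleC_of_real[symmetric] scaleC_scaleC
      by (subst complex_eq[of c]) (simp add: scaleC_add_left mult.commute)
    then show ?thesis by (simp add: linear_add[OF lin] linear_scale[OF lin])
  qed
  show ?thesis
    unfolding is_state_def clinear_functional_def
  proof (intro conjI allI)
    show "Complex (f (x + y)) (- f (\<i> *\<^sub>C (x + y))) = Complex (f x) (- f (\<i> *\<^sub>C x)) + Complex (f y) (- f (\<i> *\<^sub>C y))" for x y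
      by (simp add: linear_add[OF lin] scaleC_add_right complex_eq_iff)
    show "Complex (f (c *\<^sub>C x)) (- f (\<i> *\<^sub>C c *\<^sub>C x)) = c * Complex (f x) (- f (\<i> *\<^sub>C x))" for c x
      by (simp add: complex_eq_iff scaleC_scaleC scale[of c] scale[of "\<i> * c"])
    show "Complex (f (adj a * a)) (- f (\<i> *\<^sub>C (adj a * a))) \<in> \<real>\<^sub>\<ge>\<^sub>0" for a
      using skew_i[of "adj a * a"] nonneg[OF pos_adj_mult[of a]] by (simp add: complex_nonneg_Reals_iff adj_simps)
    show "Complex (f 1) (- f (\<i> *\<^sub>C 1)) = 1" using skew_i[of 1] by (simp add: one complex_eq_iff)
  qed
qed

text \<open>
  The cone of all \<open>x\<close> whose real part is, up to a positive factor, of the form \<open>u + m + t (b - s)\<close>, with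
  \<open>u\<close> positive, \<open>m \<in> M\<close> and \<open>t \<ge> 0\<close>, does not contain \<open>- 1\<close>.  Indeed, let \<open>v\<close> run through a partition of
  unity from \<open>(b - s)\<^sub>+\<close> and \<open>M\<close>.  Compressing \<open>b - s\<close> by each \<open>v\<close> gives a positive element or an
  element of \<open>M\<close>, so after compression and summation \<open>- 2\<close> would be positive modulo \<open>M\<close>.  A
  positive functional on this cone is the required state.
\<close>

lemma exists_state_annihilating_maximal_ideal:
  fixes M :: "'a::unital_cstar_algebra set"
  assumes M: "is_maximal_ideal M" and b: "adj b = b" and c: "pos_part (b - s *\<^sub>R 1) \<notin> M"
  obtains \<tau> where "is_state \<tau>" "\<forall>x\<in>M. \<tau> x = 0" "s \<le> Re (\<tau> b)"
proof -
  define h where "h = b - s *\<^sub>R 1"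
  define p where "p = pos_part h"
  have sah: "adj h = h" using b by (simp add: h_def adj_simps)
  have idM: "is_ideal M" using M by (rule maximal_ideal_is_ideal)
  define Q where "Q = {u + m |u m. pos u \<and> m \<in> M}"
  have Q_pos: "u \<in> Q" if "pos u" for u
  proof -
    have "u = u + 0" "0 \<in> M" using ideal_zero[OF idM] by auto
    then show ?thesis using that unfolding Q_def by blast
  qed
  have Q_M: "m \<in> Q" if "m \<in> M" for m
  proof -
    have "m = 0 + m" by simp
    then show ?thesis using that pos_zero unfolding Q_def by blast
  qed
  have Q_add: "x + y \<in> Q" if xy: "x \<in> Q" "y \<in> Q" for x y
  proof -
    obtain u m where um: "x = u + m" "pos u" "m \<in> M" using xy(1) unfolding Q_def by blast
    obtain v n where vn: "y = v + n" "pos v" "n \<in> M" using xy(2) unfolding Q_def by blast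
    have "x + y = (u + v) + (m + n)" by (simp add: um vn)
    moreover have "pos (u + v)" "m + n \<in> M" using um vn idM by (auto intro: pos_add ideal_add)
    ultimately show ?thesis unfolding Q_def by blast
  qed
  have Q_scale: "r *\<^sub>R x \<in> Q" if r: "r \<ge> 0" and x: "x \<in> Q" for r x
  proof -
    obtain u m where um: "x = u + m" "pos u" "m \<in> M" using x unfolding Q_def by blast
    have "r *\<^sub>R x = r *\<^sub>R u + r *\<^sub>R m" by (simp add: um scaleR_right_distrib)
    moreover have "pos (r *\<^sub>R u)" "r *\<^sub>R m \<in> M" using um r idM by (auto intro: pos_scaleR ideal_scaleR)
    ultimately show ?thesis unfolding Q_def by blast
  qed
  have Q_sum: "(\<Sum>v\<leftarrow>vs. g v) \<in> Q" if "\<And>v. v \<in> set vs \<Longrightarrow> g v \<in> Q" for vs :: "'a list" and g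
    using that by (induction vs) (auto intro: Q_add Q_pos)
  define C0 where "C0 = {x. \<exists>q\<in>Q. \<exists>t\<ge>0. x + adj x = q + t *\<^sub>R h}"
  have C0I: "x \<in> C0" if "x + adj x = q + t *\<^sub>R h" "q \<in> Q" "t \<ge> 0" for x q t
    unfolding C0_def using that by blast
  have C0Q: "x \<in> C0" if "x + adj x \<in> Q" for x using C0I[of x "x + adj x" 0] that by simp
  have cone: "convex_cone C0"
    unfolding convex_cone_def
  proof (intro conjI ballI allI impI)
    show "0 \<in> C0" using C0Q[of 0] Q_pos by simp
    show "x + y \<in> C0" if xy: "x \<in> C0" "y \<in> C0" for x y
    proof -
      obtain q t where q: "x + adj x = q + t *\<^sub>R h" "q \<in> Q" "t \<ge> 0" using xy(1) unfolding C0_def by blast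
      obtain q' t' where q': "y + adj y = q' + t' *\<^sub>R h" "q' \<in> Q" "t' \<ge> 0" using xy(2) unfolding C0_def by blast
      have "(x + y) + adj (x + y) = (x + adj x) + (y + adj y)" by (simp add: adj_add)
      also have "\<dots> = (q + q') + (t + t') *\<^sub>R h" unfolding q q' by (simp add: algebra_simps)
      finally show ?thesis by (rule C0I) (use q q' Q_add in auto)
    qed
    show "r *\<^sub>R x \<in> C0" if r: "r \<ge> 0" and x: "x \<in> C0" for r x
    proof -
      obtain q t where q: "x + adj x = q + t *\<^sub>R h" "q \<in> Q" "t \<ge> 0" using x unfolding C0_def by blast
      have "r *\<^sub>R x + adj (r *\<^sub>R x) = r *\<^sub>R (x + adj x)" by (simp add: adj_scaleR scaleR_right_distrib)
      also have "\<dots> = r *\<^sub>R q + (r * t) *\<^sub>R h" unfolding q by (simp add: algebra_simps)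
      finally show ?thesis by (rule C0I) (use q r Q_scale in auto)
    qed
  qed
  have one: "1 \<in> C0" by (rule C0Q) (use Q_pos[OF pos_add[OF pos_one pos_one]] in simp)
  have unit: "\<exists>t. t *\<^sub>R 1 - x \<in> C0" for x
  proof -
    define t where "t = norm (x + adj x)"
    have "pos (t *\<^sub>R 1 - (x + adj x))"
      by (rule pos_norm_minus) (simp_all add: t_def adj_simps add.commute)
    then have "t *\<^sub>R 1 - (x + adj x) \<in> Q" by (rule Q_pos)
    moreover have "((t / 2) *\<^sub>R 1 - x) + adj ((t / 2) *\<^sub>R 1 - x) = t *\<^sub>R 1 - (x + adj x)"
      by (simp add: adj_simps algebra_simps flip: scaleR_add_left)
    ultimately have "(t / 2) *\<^sub>R 1 - x \<in> C0" by (intro C0Q) (simp only:)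
    then show ?thesis by blast
  qed
  have not: "- 1 \<notin> C0"
  proof
    assume "- 1 \<in> C0"
    then obtain q t where q: "- 1 + adj (- 1) = q + t *\<^sub>R h" "q \<in> Q" "t \<ge> 0" unfolding C0_def by blast
    have "\<not> insert p M \<subseteq> K" if "is_maximal_ideal K" for K
      using maximal_ideal_subset_eq M c that unfolding p_def h_def by blast
    then obtain vs where vs: "\<And>v. v \<in> set vs \<Longrightarrow> \<exists>g\<in>insert p M. \<exists>y. v = g * y" "sum_sq vs = 1"
      using partition_of_unity by blast
    have "(\<Sum>v\<leftarrow>vs. adj v * (- 1 + adj (- 1)) * v) \<in> Q"
    proof (rule Q_sum)
      fix v assume v: "v \<in> set vs"
      obtain u m where um: "q = u + m" "pos u" "m \<in> M" using q(2) unfolding Q_def by blast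
      have "adj v * h * v \<in> Q"
      proof (cases "v \<in> M")
        case True
        then show ?thesis by (intro Q_M ideal_mult_left idM)
      next
        case False
        then obtain y where y: "v = p * y" using vs(1)[OF v] ideal_mult_right[OF idM] by blast
        have "adj v * h * v = adj y * (p * h * p) * y"
          using pos_selfadjoint[OF pos_part(1)[OF sah]] by (simp add: y adj_simps p_def mult.assoc)
        then show ?thesis using pos_conj[OF pos_part(4)[OF sah]] by (intro Q_pos) (simp add: p_def)
      qed
      then have "t *\<^sub>R (adj v * h * v) \<in> Q" using q(3) by (rule Q_scale[rotated])
      moreover have "adj v * u * v \<in> Q" using um(2) by (intro Q_pos pos_conj)
      moreover have "adj v * m * v \<in> Q" using um(3) by (intro Q_M ideal_mult_right ideal_mult_left idM)
      moreover have "adj v * (- 1 + adj (- 1)) * v = adj v * u * v + adj v * m * v + t *\<^sub>R (adj v * h * v)"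
        unfolding q(1) um(1) by (simp add: algebra_simps)
      ultimately show "adj v * (- 1 + adj (- 1)) * v \<in> Q" using Q_add by simp
    qed
    moreover have "(\<Sum>v\<leftarrow>vs. adj v * (- 1 + adj (- 1)) * v) = - (2 *\<^sub>R sum_sq vs)"
    proof -
      have "- 1 + adj (- 1) = (- 2) *\<^sub>R (1 :: 'a)" by (simp add: adj_minus scaleR_conv_of_real)
      then show ?thesis by (simp only:) (induction vs; simp add: algebra_simps)
    qed
    ultimately have "- (2 *\<^sub>R 1) \<in> Q" using vs(2) by simp
    then obtain u m where um: "- (2 *\<^sub>R 1) = u + m" "pos u" "m \<in> M" unfolding Q_def by blast
    have "u + 2 *\<^sub>R 1 = - m" using um(1) by (metis add.commute add.left_commute add.right_inverse add_0_right minus_add_cancel minus_minus)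
    then have "u + 2 *\<^sub>R 1 \<in> M" using ideal_minus[OF idM um(3)] by simp
    then show False using ideal_pos_plus[OF idM maximal_ideal_one[OF M] um(2), of 2] by simp
  qed
  obtain f :: "'a \<Rightarrow> real" where f: "linear f" "f 1 = 1" "\<forall>x\<in>C0. 0 \<le> f x"
    by (rule cone_functional[OF cone not one unit])
  have f_pos: "0 \<le> f x" if "pos x" for x
    by (rule bspec[OF f(3)], rule C0Q) (use that in \<open>simp add: pos_selfadjoint Q_pos pos_add\<close>)
  have f_zero: "f x = 0" if "x \<in> C0" "- x \<in> C0" for x
    using bspec[OF f(3) that(1)] bspec[OF f(3) that(2)] by (simp add: linear_neg[OF f(1)])
  have skew: "f x = 0" if "adj x = - x" for x
    by (rule f_zero; rule C0Q) (use that in \<open>simp_all add: adj_minus Q_pos\<close>)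
  define \<tau> where "\<tau> = (\<lambda>x. Complex (f x) (- f (\<i> *\<^sub>C x)))"
  have st: "is_state \<tau>" unfolding \<tau>_def by (rule state_of_real_functional[OF f(1,2) f_pos skew])
  have "\<tau> x = 0" if x: "x \<in> M" for x
  proof (rule state_zero_of_square_zero[OF st])
    have "adj x * x \<in> M" using idM x by (rule ideal_mult_left)
    then have "r *\<^sub>R (adj x * x) \<in> M" for r by (rule ideal_scaleR[OF idM])
    from this[of 2] this[of "-2"] have "2 *\<^sub>R (adj x * x) \<in> M" "- (2 *\<^sub>R (adj x * x)) \<in> M" by simp_all
    then have "f (adj x * x) = 0"
      by (intro f_zero C0Q Q_M) (simp_all add: adj_simps scaleR_2)
    then show "\<tau> (adj x * x) = 0"
      using state_pos[OF st pos_adj_mult[of x]] by (simp add: complex_eq_iff \<tau>_def)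
  qed
  moreover have "s \<le> Re (\<tau> b)"
  proof -
    have "h \<in> C0" by (rule C0I[of h 0 2]) (simp_all add: sah scaleR_2 Q_pos)
    then have "0 \<le> f h" by (rule bspec[OF f(3)])
    then show ?thesis by (simp add: h_def \<tau>_def linear_diff[OF f(1)] linear_scale[OF f(1)] f(2))
  qed
  ultimately show ?thesis using that st by blast
qed

section \<open>Density and the main result\<close>

theorem maximally_mixed_dense:
  fixes \<omega> :: "'a::unital_cstar_algebra \<Rightarrow> complex"
  assumes w: "is_state \<omega>" and w0: "\<And>x. x \<in> strong_radical \<Longrightarrow> \<omega> x = 0"
  shows "\<omega> \<in> closure {\<omega>. maximally_mixed \<omega>}"
proof -
  define D where "D = {\<tau> :: 'a \<Rightarrow> complex. is_state \<tau> \<and> (\<exists>\<M>. finite \<M> \<and> \<M> \<noteq> {} \<and>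
    (\<forall>M\<in>\<M>. is_maximal_ideal M) \<and> (\<forall>x\<in>\<Inter>\<M>. \<tau> x = 0))}"
  have "D \<subseteq> {\<omega>. maximally_mixed \<omega>}"
  proof
    fix \<tau> assume "\<tau> \<in> D"
    then obtain \<M> where M: "is_state \<tau>" "finite \<M>" "\<M> \<noteq> {}" "\<forall>M\<in>\<M>. is_maximal_ideal M" "\<forall>x\<in>\<Inter>\<M>. \<tau> x = 0"
      unfolding D_def by blast
    then have "maximally_mixed \<tau>"
      by (intro maximally_mixed_of_finite_intersection[of \<tau> \<M>]) auto
    then show "\<tau> \<in> {\<omega>. maximally_mixed \<omega>}" by simp
  qed
  moreover have "\<omega> \<in> closure D"
  proof (rule ccontr)
    assume out: "\<omega> \<notin> closure D"
    have D: "is_state f" if "f \<in> D" for f using that by (simp add: D_def)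
    have conv: "(\<lambda>x. complex_of_real (1 - t) * f x + complex_of_real t * g x) \<in> D"
      if fg: "f \<in> D" "g \<in> D" and t: "0 \<le> t" "t \<le> 1" for f g t
    proof -
      let ?k = "\<lambda>x. complex_of_real (1 - t) * f x + complex_of_real t * g x"
      obtain \<M> where M: "finite \<M>" "\<M> \<noteq> {}" "\<forall>M\<in>\<M>. is_maximal_ideal M" "\<forall>x\<in>\<Inter>\<M>. f x = 0"
        using fg(1) unfolding D_def by blast
      obtain \<N> where N: "finite \<N>" "\<N> \<noteq> {}" "\<forall>M\<in>\<N>. is_maximal_ideal M" "\<forall>x\<in>\<Inter>\<N>. g x = 0"
        using fg(2) unfolding D_def by blast
      note st = D[OF fg(1)] D[OF fg(2)]
      have "is_state ?k"
        unfolding is_state_def clinear_functional_def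
      proof (intro conjI allI)
        show "?k (adj a * a) \<in> \<real>\<^sub>\<ge>\<^sub>0" for a
          using state_pos[OF st(1) pos_adj_mult[of a]] state_pos[OF st(2) pos_adj_mult[of a]] t
          by (simp add: complex_nonneg_Reals_iff)
      qed (simp_all add: state_linear[OF st(1)] state_linear[OF st(2)] algebra_simps)
      moreover have "\<forall>x\<in>\<Inter>(\<M> \<union> \<N>). ?k x = 0" using M(4) N(4) by auto
      ultimately show ?thesis unfolding D_def using M(1-3) N(1-3)
        by (intro CollectI conjI exI[of _ "\<M> \<union> \<N>"]) auto
    qed
    from separation[of D, OF D conv w out]
    obtain a d where ad: "adj a = a" "d > 0" "\<forall>f\<in>D. Re (\<omega> a) + d \<le> Re (f a)" .
    \<comment> \<open>\<open>s\<close> lies halfway inside the gap between \<open>\<omega>\<close> and \<open>D\<close> at \<open>b\<close>\<close>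
    define b where "b = - a"
    define s where "s = Re (\<omega> b) - d / 2"
    have b: "adj b = b" using ad(1) by (simp add: b_def adj_minus)
    have "pos_part (b - s *\<^sub>R 1) \<in> M" if M: "is_maximal_ideal M" for M
    proof (rule ccontr)
      assume "pos_part (b - s *\<^sub>R 1) \<notin> M"
      from exists_state_annihilating_maximal_ideal[OF M b this]
      obtain \<tau> where t: "is_state \<tau>" "\<forall>x\<in>M. \<tau> x = 0" "s \<le> Re (\<tau> b)" .
      have "\<tau> \<in> D" unfolding D_def using t(1,2) M by (intro CollectI conjI exI[of _ "{M}"]) auto
      from bspec[OF ad(3) this] show False
        using t(3) ad(2) by (simp add: s_def b_def state_minus[OF w] state_minus[OF t(1)])
    qed
    then have "\<omega> (pos_part (b - s *\<^sub>R 1)) = 0" by (intro w0) (simp add: strong_radical_def)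
    moreover have "pos (pos_part (b - s *\<^sub>R 1) - (b - s *\<^sub>R 1))" by (rule pos_part) (simp add: adj_simps b)
    from state_mono[OF w this] have "Re (\<omega> (b - s *\<^sub>R 1)) \<le> Re (\<omega> (pos_part (b - s *\<^sub>R 1)))" .
    ultimately have "Re (\<omega> b) \<le> s" by (simp add: state_linear[OF w])
    then show False using ad(2) by (simp add: s_def)
  qed
  ultimately show ?thesis using closure_mono by blast
qed

theorem theorem4p4:
  shows "(\<forall>\<omega> :: 'a::unital_cstar_algebra \<Rightarrow> complex.
            maximally_mixed \<omega> \<longrightarrow> (\<forall>x\<in>strong_radical. \<omega> x = 0)) \<and>
         (\<forall>(\<omega> :: 'a \<Rightarrow> complex) \<M>.
            is_state \<omega> \<and> finite \<M> \<and> \<M> \<noteq> {} \<and> (\<forall>M\<in>\<M>. is_maximal_ideal M) \<and>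
            (\<forall>x\<in>\<Inter>\<M>. \<omega> x = 0) \<longrightarrow> maximally_mixed \<omega>) \<and>
         {\<omega> :: 'a \<Rightarrow> complex. maximally_mixed \<omega>} \<subseteq> annihilating_states strong_radical \<and>
         subtopology weak_star (annihilating_states strong_radical)
           closure_of {\<omega> :: 'a \<Rightarrow> complex. maximally_mixed \<omega>}
         = annihilating_states strong_radical"
proof (intro conjI)
  let ?S = "{\<omega> :: 'a \<Rightarrow> complex. maximally_mixed \<omega>}"
  let ?A = "annihilating_states strong_radical :: ('a \<Rightarrow> complex) set"
  show "\<forall>\<omega> :: 'a \<Rightarrow> complex. maximally_mixed \<omega> \<longrightarrow> (\<forall>x\<in>strong_radical. \<omega> x = 0)"
    using maximally_mixed_annihilates_radical by blast
  show "\<forall>(\<omega> :: 'a \<Rightarrow> complex) \<M>.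
            is_state \<omega> \<and> finite \<M> \<and> \<M> \<noteq> {} \<and> (\<forall>M\<in>\<M>. is_maximal_ideal M) \<and>
            (\<forall>x\<in>\<Inter>\<M>. \<omega> x = 0) \<longrightarrow> maximally_mixed \<omega>"
  proof (intro allI impI, elim conjE)
    fix \<omega> :: "'a \<Rightarrow> complex" and \<M>
    assume "is_state \<omega>" "finite \<M>" "\<M> \<noteq> {}" "\<forall>M\<in>\<M>. is_maximal_ideal M" "\<forall>x\<in>\<Inter>\<M>. \<omega> x = 0"
    then show "maximally_mixed \<omega>"
      by (intro maximally_mixed_of_finite_intersection[of \<omega> \<M>]) auto
  qed
  show SA: "?S \<subseteq> ?A"
    using maximally_mixed_annihilates_radical
    by (auto simp: annihilating_states_def maximally_mixed_def)
  have states: "?A \<subseteq> {\<omega>. is_state \<omega>}" by (auto simp: annihilating_states_def)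
  have "subtopology weak_star ?A closure_of ?S = ?A \<inter> weak_star closure_of (?A \<inter> ?S)"
    by (rule closure_of_subtopology)
  also have "?A \<inter> ?S = ?S" using SA by blast
  also have "weak_star closure_of ?S = closure ?S"
    by (rule weak_star_closure_of_states) (use SA states in blast)
  also have "?A \<inter> closure ?S = ?A"
    using maximally_mixed_dense by (auto simp: annihilating_states_def)
  finally show "subtopology weak_star ?A closure_of ?S = ?A" .
qed

end
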